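(* Let $\mu$ be a distribution with discrete support, let $\delta\in(0,1)$, and let $C_{\delta/2}$ be a subset of the support of minimum size such that $\mu(C_{\delta/2}) \ge 1-\delta/2$. Assume access to: (a) a labeling oracle $\mathcal{O}_{\mathrm{label}}$ that assigns labels $0,\dots,m-1$ to the elements of $C_{\delta/2}$ (where $m=|C_{\delta/2}|$) and, given $i\in\{0,\dots,m-1\}$, returns the corresponding element; (b) a binary probability oracle $\mathcal{O}_{\mathrm{bin}}$ that, given $x\in C_{\delta/2}$ and $\ell\in\mathbb{N}_+$, returns the first $\ell$ bits after the binary point of $\mu(x)$. Then there exists a $(0,\delta)$-approximate time-oblivious sampler for $\mu$ that: (1) uses $2^{\lceil \log_2 |C_{\delta/2}|\rceil}\left(\lceil\log_2\frac2\delta\rceil + \lceil\log_2|C_{\delta/2}|\rceil\right)$ bits of memory, which is $O\!\left(|C_{\delta/2}|\left(\ln\frac1\delta + \ln|C_{\delta/2}|\right)\right)$; (2) consumes at most $\log_2|C_{\delta/2}| + \log_2\frac1\delta + O(1)$ unbiased random bits per sample, and runs in $O\!\left(\frac1\omega\left(\log_2|C_{\delta/2}| + \log_2\frac1\delta\right)\right)$ time per sample in the word-RAM model.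
   Context: Computational model: word-RAM with $\omega$-bit words; basic word operations cost $O(1)$; running time counts word operations. A sampler $\mathcal{A}_\mu$ for a distribution $\mu$ on $(\mathcal{Z},\mathcal{F})$ is an algorithm taking an infinite sequence $\vec s$ of unbiased random bits and outputting an element of $\mathcal{Z}$; let $T(\vec s)$ denote its running time on $\vec s$. $\mathcal{A}_\mu$ is an $(\varepsilon,\delta)$-approximate time-oblivious sampler for $\mu$ if for every $T\subseteq\mathbb{N}$ with $\Pr_{\vec s}[T(\vec s)\in T]>0$ ($\vec s$ uniform in $\{0,1\}^{\mathbb{N}}$) and every $E\in\mathcal{F}$: $e^{-\varepsilon}(\mu(E)-\delta)\le \Pr_{\vec s}[\mathcal{A}_\mu(\vec s)\in E \mid T(\vec s)\in T]\le e^{\varepsilon}\mu(E)+\delta$.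
   Formalization: O(g) for memory and time is read as O(max(1,g)), since g can tend to 0; words are assumed large enough to address the memory claimed in (1) (its bits are at most ω·2^ω); constants are stated per type of elements, uniform ones following by encoding the countable support in ℕ. *)

theory Defs
  imports "HOL-Probability.Probability"
begin

section \<open>Samplers\<close>

definition coins :: "(nat \<Rightarrow> bool) measure" where
  "coins = PiM UNIV (\<lambda>_. measure_pmf (bernoulli_pmf (1/2)))"

text \<open>\<open>A s\<close> is the output and \<open>T s\<close> the running time on the random bit sequence \<open>s\<close>. The two
  measurability conditions make all the probabilities below meaningful (\<^const>\<open>measure\<close> is 0 on
  non-measurable sets).\<close>

definition time_oblivious_sampler ::
  "real \<Rightarrow> real \<Rightarrow> 'a measure \<Rightarrow> ((nat \<Rightarrow> bool) \<Rightarrow> 'a) \<Rightarrow> ((nat \<Rightarrow> bool) \<Rightarrow> nat) \<Rightarrow> bool" where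
  "time_oblivious_sampler \<epsilon> \<delta> \<mu> A T \<longleftrightarrow>
     A \<in> measurable coins \<mu> \<and> T \<in> measurable coins (count_space UNIV) \<and>
     (\<forall>X. measure coins {s \<in> space coins. T s \<in> X} > 0 \<longrightarrow>
       (\<forall>E \<in> sets \<mu>.
          exp (- \<epsilon>) * (measure \<mu> E - \<delta>) \<le> cond_prob coins (\<lambda>s. A s \<in> E) (\<lambda>s. T s \<in> X) \<and>
          cond_prob coins (\<lambda>s. A s \<in> E) (\<lambda>s. T s \<in> X) \<le> exp \<epsilon> * measure \<mu> E + \<delta>))"

definition minimum_core :: "'a pmf \<Rightarrow> real \<Rightarrow> 'a set \<Rightarrow> bool" where
  "minimum_core \<mu> \<eta> C \<longleftrightarrow>
     is_arg_min card (\<lambda>D. finite D \<and> D \<subseteq> set_pmf \<mu> \<and> measure_pmf.prob \<mu> D \<ge> 1 - \<eta>) C"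


section \<open>Oracles\<close>

definition label_oracle :: "'a set \<Rightarrow> (nat \<Rightarrow> 'a) \<Rightarrow> bool" where
  "label_oracle C lab \<longleftrightarrow> bij_betw lab {..<card C} C"

text \<open>Most significant bit first. The binary expansion of a dyadic number is the terminating one;
  in particular all the bits of 1 after the binary point are 0.\<close>

definition first_bits :: "real \<Rightarrow> nat \<Rightarrow> bool list" where
  "first_bits p l = map (\<lambda>j. odd \<lfloor>p * 2 ^ j\<rfloor>) [1..<Suc l]"

definition bin_oracle :: "'a pmf \<Rightarrow> 'a set \<Rightarrow> ('a \<Rightarrow> nat \<Rightarrow> bool list) \<Rightarrow> bool" where
  "bin_oracle \<mu> C obin \<longleftrightarrow> (\<forall>x\<in>C. \<forall>l\<ge>1. obin x l = first_bits (pmf \<mu> x) l)"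


section \<open>Randomized word-RAM with oracles\<close>

text \<open>Words are natural numbers below \<open>2 ^ \<omega>\<close>; the word size is a value rather than a type, so that
  constants can be stated uniformly in it. A machine has word registers and a memory consisting of
  a fixed number of bits, accessed in aligned words of \<open>\<omega>\<close> bits (the last word may be incomplete).\<close>

datatype binop = Add | Sub | Mul | Div | Mod | And | Or | Xor | Shl | Shr | Lt | Eq

fun eval_binop :: "nat \<Rightarrow> binop \<Rightarrow> nat \<Rightarrow> nat \<Rightarrow> nat" where
  "eval_binop \<omega> Add a b = (a + b) mod 2 ^ \<omega>"
| "eval_binop \<omega> Sub a b = (a + 2 ^ \<omega> - b) mod 2 ^ \<omega>"
| "eval_binop \<omega> Mul a b = (a * b) mod 2 ^ \<omega>"
| "eval_binop \<omega> Div a b = a div b"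
| "eval_binop \<omega> Mod a b = a mod b"
| "eval_binop \<omega> And a b = Bit_Operations.and a b"
| "eval_binop \<omega> Or a b = Bit_Operations.or a b"
| "eval_binop \<omega> Xor a b = Bit_Operations.xor a b"
| "eval_binop \<omega> Shl a b = (a * 2 ^ b) mod 2 ^ \<omega>"
| "eval_binop \<omega> Shr a b = a div 2 ^ b"
| "eval_binop \<omega> Lt a b = of_bool (a < b)"
| "eval_binop \<omega> Eq a b = of_bool (a = b)"

text \<open>The type parameter \<open>'r\<close> is the type of register names; the set functions \<open>instr_regs\<close> and
  \<open>regs\<close> give the registers occurring in an instruction or a program.

  \<open>Rand d b\<close> draws \<open>b\<close> fresh random bits, at most one word, in a single operation.
  \<open>Ask_Bin r ls\<close> queries the binary probability oracle on the element with the label in \<open>r\<close>; the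
  requested number of bits is the multi-word number held by the registers \<open>ls\<close> (least significant
  word first), and the reply is then consumed bit by bit by \<open>Next_Bit\<close>.
  \<open>Emit r\<close> passes the label in \<open>r\<close> to the labeling oracle and outputs the element returned.\<close>

datatype (instr_regs: 'r) instr =
    Const 'r nat
  | Op binop 'r 'r 'r
  | Load 'r 'r
  | Store 'r 'r
  | Rand 'r nat
  | Ask_Bin 'r "'r list"
  | Next_Bit 'r
  | Emit 'r

datatype (regs: 'r) prog =
    Skip
  | Do "'r instr"
  | Seq "'r prog" "'r prog"
  | If 'r "'r prog" "'r prog"
  | While 'r "'r prog"

record 'a state =
  reg :: "nat \<Rightarrow> nat"
  mem :: "bool list"
  used :: nat  \<comment> \<open>number of random bits consumed\<close>
  reply :: "bool list"
  result :: "'a option"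

definition init_state :: "bool list \<Rightarrow> 'a state" where
  "init_state M = \<lparr>reg = (\<lambda>_. 0), mem = M, used = 0, reply = [], result = None\<rparr>"

definition load_word :: "nat \<Rightarrow> bool list \<Rightarrow> nat \<Rightarrow> nat" where
  "load_word \<omega> M a = horner_sum of_bool 2 (take \<omega> (drop (a * \<omega>) M))"

definition store_word :: "nat \<Rightarrow> bool list \<Rightarrow> nat \<Rightarrow> nat \<Rightarrow> bool list" where
  "store_word \<omega> M a v =
     map (\<lambda>i. if i div \<omega> = a then bit v (i mod \<omega>) else M ! i) [0..<length M]"

definition set_reg :: "nat \<Rightarrow> nat \<Rightarrow> 'a state \<Rightarrow> 'a state" where
  "set_reg d v \<sigma> = \<sigma>\<lparr>reg := (reg \<sigma>)(d := v)\<rparr>"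

fun step ::
  "nat \<Rightarrow> (nat \<Rightarrow> 'a) \<Rightarrow> ('a \<Rightarrow> nat \<Rightarrow> bool list) \<Rightarrow> (nat \<Rightarrow> bool) \<Rightarrow> nat instr \<Rightarrow> 'a state \<Rightarrow> 'a state"
where
  "step \<omega> lab obin s (Const d v) \<sigma> = set_reg d (v mod 2 ^ \<omega>) \<sigma>"
| "step \<omega> lab obin s (Op f d a b) \<sigma> = set_reg d (eval_binop \<omega> f (reg \<sigma> a) (reg \<sigma> b)) \<sigma>"
| "step \<omega> lab obin s (Load d a) \<sigma> = set_reg d (load_word \<omega> (mem \<sigma>) (reg \<sigma> a)) \<sigma>"
| "step \<omega> lab obin s (Store a v) \<sigma> =
     \<sigma>\<lparr>mem := store_word \<omega> (mem \<sigma>) (reg \<sigma> a) (reg \<sigma> v)\<rparr>"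
| "step \<omega> lab obin s (Rand d b) \<sigma> =
     set_reg d (horner_sum of_bool 2 (map s [used \<sigma>..<used \<sigma> + min b \<omega>]))
       (\<sigma>\<lparr>used := used \<sigma> + min b \<omega>\<rparr>)"
| "step \<omega> lab obin s (Ask_Bin r ls) \<sigma> =
     \<sigma>\<lparr>reply := obin (lab (reg \<sigma> r)) (horner_sum id (2 ^ \<omega>) (map (reg \<sigma>) ls))\<rparr>"
| "step \<omega> lab obin s (Next_Bit d) \<sigma> =
     set_reg d (of_bool (reply \<sigma> \<noteq> [] \<and> hd (reply \<sigma>))) (\<sigma>\<lparr>reply := tl (reply \<sigma>)\<rparr>)"
| "step \<omega> lab obin s (Emit r) \<sigma> = \<sigma>\<lparr>result := Some (lab (reg \<sigma> r))\<rparr>"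

fun cost :: "'r instr \<Rightarrow> nat" where
  "cost (Ask_Bin r ls) = 1 + length ls"
| "cost _ = 1"

text \<open>\<open>exec \<omega> lab obin s P \<sigma> t \<sigma>'\<close>: on the random bit sequence \<open>s\<close>, program \<open>P\<close> started in \<open>\<sigma>\<close>
  terminates in \<open>\<sigma>'\<close> after \<open>t\<close> word operations.\<close>

inductive exec ::
  "nat \<Rightarrow> (nat \<Rightarrow> 'a) \<Rightarrow> ('a \<Rightarrow> nat \<Rightarrow> bool list) \<Rightarrow> (nat \<Rightarrow> bool) \<Rightarrow>
   nat prog \<Rightarrow> 'a state \<Rightarrow> nat \<Rightarrow> 'a state \<Rightarrow> bool"
  for \<omega> lab obin s
where
  Skip: "exec \<omega> lab obin s Skip \<sigma> 0 \<sigma>"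
| Do: "exec \<omega> lab obin s (Do i) \<sigma> (cost i) (step \<omega> lab obin s i \<sigma>)"
| Seq: "\<lbrakk>exec \<omega> lab obin s P \<sigma> t \<sigma>'; exec \<omega> lab obin s Q \<sigma>' u \<sigma>''\<rbrakk>
    \<Longrightarrow> exec \<omega> lab obin s (Seq P Q) \<sigma> (t + u) \<sigma>''"
| If_True: "\<lbrakk>reg \<sigma> r \<noteq> 0; exec \<omega> lab obin s P \<sigma> t \<sigma>'\<rbrakk>
    \<Longrightarrow> exec \<omega> lab obin s (If r P Q) \<sigma> (1 + t) \<sigma>'"
| If_False: "\<lbrakk>reg \<sigma> r = 0; exec \<omega> lab obin s Q \<sigma> t \<sigma>'\<rbrakk>
    \<Longrightarrow> exec \<omega> lab obin s (If r P Q) \<sigma> (1 + t) \<sigma>'"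
| While_True: "\<lbrakk>reg \<sigma> r \<noteq> 0; exec \<omega> lab obin s P \<sigma> t \<sigma>'; exec \<omega> lab obin s (While r P) \<sigma>' u \<sigma>''\<rbrakk>
    \<Longrightarrow> exec \<omega> lab obin s (While r P) \<sigma> (1 + t + u) \<sigma>''"
| While_False: "reg \<sigma> r = 0 \<Longrightarrow> exec \<omega> lab obin s (While r P) \<sigma> 1 \<sigma>"


section \<open>Samplers on the word-RAM\<close>

text \<open>A sampler is a pair of programs on a machine with \<open>N\<close> bits of memory. \<open>Prep\<close> is run once,
  on cleared memory, and consumes no randomness; \<open>Samp\<close> is run once per sample. \<open>Samp\<close> has to
  restore the memory contents left by \<open>Prep\<close>, so that it can be run arbitrarily often. \<open>A\<close>, \<open>T\<close> and
  \<open>R\<close> are the output, the running time and the number of random bits consumed, per sample.\<close>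

definition ram_sampler ::
  "nat \<Rightarrow> nat \<Rightarrow> (nat \<Rightarrow> 'a) \<Rightarrow> ('a \<Rightarrow> nat \<Rightarrow> bool list) \<Rightarrow> nat prog \<Rightarrow> nat prog \<Rightarrow>
   ((nat \<Rightarrow> bool) \<Rightarrow> 'a) \<Rightarrow> ((nat \<Rightarrow> bool) \<Rightarrow> nat) \<Rightarrow> ((nat \<Rightarrow> bool) \<Rightarrow> nat) \<Rightarrow> bool" where
  "ram_sampler \<omega> N lab obin Prep Samp A T R \<longleftrightarrow>
     (\<exists>M. length M = N \<and>
       (\<forall>s. \<exists>t \<sigma>. exec \<omega> lab obin s Prep (init_state (replicate N False)) t \<sigma> \<and>
              mem \<sigma> = M \<and> used \<sigma> = 0) \<and>
       (\<forall>s. \<exists>\<sigma>. exec \<omega> lab obin s Samp (init_state M) (T s) \<sigma> \<and>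
              mem \<sigma> = M \<and> used \<sigma> = R s \<and> result \<sigma> = Some (A s)))"

definition table_bits :: "nat \<Rightarrow> real \<Rightarrow> nat" where
  "table_bits m \<delta> =
     2 ^ nat \<lceil>log 2 (real m)\<rceil> * (nat \<lceil>log 2 (2 / \<delta>)\<rceil> + nat \<lceil>log 2 (real m)\<rceil>)"

end

theory Submission
  imports Defs
begin

text \<open>Let \<open>k = \<lceil>log 2 m\<rceil>\<close> and \<open>L = k + \<lceil>log 2 (2 / \<delta>)\<rceil>\<close>. Rounding the probabilities of the labels down
  to multiples of \<open>1 / 2 ^ L\<close> and giving the remaining mass to label 0 costs at most \<open>\<delta> / 2\<close>, and
  ignoring the elements outside the core costs another \<open>\<delta> / 2\<close>. The rounded distribution has an alias
  table with \<open>2 ^ k\<close> columns of height \<open>2 ^ (L - k)\<close>, each stored as one \<open>L\<close>-bit number holding the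
  alias in its \<open>k\<close> low bits and the threshold above them. A uniform \<open>L\<close>-bit number likewise
  consists of a column and a height, so that sampling amounts to one multi-word comparison. It is done
  by straight-line code, whose running time is constant; time-obliviousness is then a bound on the
  total variation distance.

  The programs may depend on \<open>m\<close>, \<open>\<delta>\<close> and \<open>\<omega>\<close>, so preprocessing can be a decision tree branching on
  every bit of every oracle reply, whose leaves store a precomputed table.\<close>


section \<open>Alias tables\<close>

text \<open>Walker's alias method, removing one column at a time. Some column \<open>x\<close> has
  weight at most \<open>H\<close> by averaging; its missing height \<open>H - w x\<close> is taken
  from some \<open>y\<close> of weight at least \<open>H\<close>, which becomes its alias, and the
  remaining columns again have average \<open>H\<close>. The strict bound \<open>t i < H\<close>
  lets thresholds fit into the bits above the alias.\<close>

lemma alias_table_exists: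
  fixes w :: "'b \<Rightarrow> nat"
  assumes "finite S" "sum w S = card S * H" "H > 0"
  shows "\<exists>t a. (\<forall>i\<in>S. t i < H \<and> a i \<in> S) \<and>
           (\<forall>x\<in>S. w x = t x + (\<Sum>i | i \<in> S \<and> a i = x. H - t i))"
  using assms
proof (induction "card S" arbitrary: S w)
  case 0
  then show ?case by auto
next
  case (Suc n)
  have "\<exists>x\<in>S. w x \<le> H"
  proof (rule ccontr)
    assume "\<not> ?thesis"
    moreover have "S \<noteq> {}" using Suc.hyps(2) by auto
    ultimately have "sum (\<lambda>_. H) S < sum w S"
      using Suc.prems(1) by (intro sum_strict_mono) auto
    then show False using Suc.prems(2) by simp
  qed
  then obtain x where x: "x \<in> S" "w x \<le> H" by blast
  define S' where "S' = S - {x}"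
  have S: "S = insert x S'" "x \<notin> S'" "finite S'" "card S' = n"
    using x Suc.prems(1) Suc.hyps(2) by (auto simp: S'_def)
  have sumS': "w x + sum w S' = H + n * H"
    using Suc.prems(2) S by simp
  have upd: "{i. i \<in> S \<and> (a(x := y)) i = z} =
      (if y = z then insert x {i. i \<in> S' \<and> a i = z} else {i. i \<in> S' \<and> a i = z})"
    for a :: "'b \<Rightarrow> 'b" and y z
    using S by auto
  have upd_sum: "(\<Sum>i | i \<in> S \<and> (a(x := y)) i = z. H - (t(x := c)) i) =
      (if y = z then H - c else 0) + (\<Sum>i | i \<in> S' \<and> a i = z. H - t i)"
    for t y z c and a :: "'b \<Rightarrow> 'b"
  proof -
    define B where "B = {i. i \<in> S' \<and> a i = z}"
    have "finite B" "x \<notin> B" using S by (auto simp: B_def)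
    moreover have "(\<Sum>i\<in>B. H - (t(x := c)) i) = (\<Sum>i\<in>B. H - t i)"
      using \<open>x \<notin> B\<close> by (intro sum.cong) auto
    ultimately show ?thesis unfolding upd B_def[symmetric] by simp
  qed
  show ?case
  proof (cases "w x = H")
    case True
    then obtain t a where ta: "\<forall>i\<in>S'. t i < H \<and> a i \<in> S'"
        "\<forall>z\<in>S'. w z = t z + (\<Sum>i | i \<in> S' \<and> a i = z. H - t i)"
      using Suc.hyps(1)[of S' w] S sumS' Suc.prems(3) by auto
    have e: "{i. i \<in> S' \<and> a i = x} = {}" using ta(1) S(2) by auto
    \<comment> \<open>A full column gets threshold 0 and itself as alias, since the threshold
      \<open>H\<close> is excluded.\<close>
    have "w z = (t(x := 0)) z + ((if x = z then H - 0 else 0) + (\<Sum>i | i \<in> S' \<and> a i = z. H - t i))"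
      if "z \<in> S" for z
    proof (cases "z = x")
      case zx: True
      then have "(\<Sum>i | i \<in> S' \<and> a i = z. H - t i) = 0" using e by (simp only: sum.empty)
      then show ?thesis using zx True by simp
    next
      case False
      then show ?thesis using ta(2) that S(1) by auto
    qed
    then have "\<forall>z\<in>S. w z = (t(x := 0)) z + (\<Sum>i | i \<in> S \<and> (a(x := x)) i = z. H - (t(x := 0)) i)"
      unfolding upd_sum by (rule ballI)
    moreover have "(t(x := 0)) i < H \<and> (a(x := x)) i \<in> S" if "i \<in> S" for i
      using ta(1) S(1) x Suc.prems(3) that by (cases "i = x") auto
    ultimately show ?thesis by blast
  next
    case False
    \<comment> \<open>As \<open>w x < H\<close>, the other \<open>n\<close> columns carry more than
      \<open>n * H\<close> in total.\<close>
    have "\<exists>y\<in>S'. w y \<ge> H"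
    proof (rule ccontr)
      assume "\<not> ?thesis"
      then have "sum w S' \<le> sum (\<lambda>_. H) S'"
        by (intro sum_mono) (auto simp: not_le less_imp_le)
      then have "sum w S' \<le> n * H" using S by simp
      then show False using sumS' False x by linarith
    qed
    then obtain y where y: "y \<in> S'" "w y \<ge> H" by blast
    define w' where "w' = w(y := w y - (H - w x))"
    have "sum w' S' = (w y - (H - w x)) + sum w (S' - {y})"
      using y S by (subst sum.remove[of S' y]) (auto simp: w'_def intro!: sum.cong)
    moreover have "sum w S' = w y + sum w (S' - {y})"
      using y S by (subst sum.remove[of S' y]) auto
    ultimately have "sum w' S' = n * H" using y sumS' x by linarith
    then obtain t a where ta: "\<forall>i\<in>S'. t i < H \<and> a i \<in> S'"
        "\<forall>z\<in>S'. w' z = t z + (\<Sum>i | i \<in> S' \<and> a i = z. H - t i)"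
      using Suc.hyps(1)[of S' w'] S Suc.prems(3) by auto
    have e: "{i. i \<in> S' \<and> a i = x} = {}" using ta(1) S(2) by auto
    have xy: "x \<noteq> y" using y S by auto
    have "w z = (t(x := w x)) z + ((if y = z then H - w x else 0) + (\<Sum>i | i \<in> S' \<and> a i = z. H - t i))"
      if "z \<in> S" for z
    proof (cases "z = x")
      case True
      then have "(\<Sum>i | i \<in> S' \<and> a i = z. H - t i) = 0" using e by (simp only: sum.empty)
      then show ?thesis using True xy by simp
    next
      case zx: False
      then have "w' z = t z + (\<Sum>i | i \<in> S' \<and> a i = z. H - t i)" using ta(2) that S by auto
      then show ?thesis using zx y x by (auto simp: w'_def split: if_splits)
    qed
    then have "\<forall>z\<in>S. w z = (t(x := w x)) z + (\<Sum>i | i \<in> S \<and> (a(x := y)) i = z. H - (t(x := w x)) i)"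
      unfolding upd_sum by (rule ballI)
    moreover have "(t(x := w x)) i < H \<and> (a(x := y)) i \<in> S" if "i \<in> S" for i
      using ta(1) y(1) S(1) False x that by (cases "i = x") auto
    ultimately show ?thesis by blast
  qed
qed

definition alias_sample :: "nat \<Rightarrow> (nat \<Rightarrow> nat) \<Rightarrow> (nat \<Rightarrow> nat) \<Rightarrow> nat \<Rightarrow> nat" where
  "alias_sample n t a v = (if v div n < t (v mod n) then v mod n else a (v mod n))"

text \<open>Writing \<open>v = i + n * u\<close> splits the samples into columns \<open>i\<close> of
  height \<open>H\<close>: the heights below \<open>t i\<close> yield \<open>i\<close>, the
  remaining \<open>H - t i\<close> yield \<open>a i\<close>.\<close>

lemma card_alias_sample:
  assumes t: "\<And>i. i < n \<Longrightarrow> t i < H" and x: "x < n"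
  shows "card {v. v < n * H \<and> alias_sample n t a v = x} =
           t x + (\<Sum>i | i < n \<and> a i = x. H - t i)"
proof -
  define U where "U i = {u. u < H \<and> (if u < t i then i else a i) = x}" for i
  have "bij_betw (\<lambda>(i, u). i + n * u) (SIGMA i:{..<n}. U i) {v. v < n * H \<and> alias_sample n t a v = x}"
  proof (rule bij_betwI[where g = "\<lambda>v. (v mod n, v div n)"])
    show "(\<lambda>(i, u). i + n * u) \<in> (SIGMA i:{..<n}. U i) \<rightarrow> {v. v < n * H \<and> alias_sample n t a v = x}"
    proof -
      have "i + n * u < n * H" if "i < n" "u < H" for i u
      proof -
        have "i + n * u < n * Suc u" using \<open>i < n\<close> by simp
        also have "n * Suc u \<le> n * H" using \<open>u < H\<close> by (intro mult_le_mono2) simp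
        finally show ?thesis .
      qed
      then show ?thesis by (auto simp: U_def alias_sample_def)
    qed
    show "(\<lambda>v. (v mod n, v div n)) \<in> {v. v < n * H \<and> alias_sample n t a v = x} \<rightarrow> (SIGMA i:{..<n}. U i)"
      using x by (auto simp: U_def alias_sample_def less_mult_imp_div_less mult.commute)
  qed (auto simp: U_def)
  then have "card {v. v < n * H \<and> alias_sample n t a v = x} = card (SIGMA i:{..<n}. U i)"
    by (rule bij_betw_same_card[symmetric])
  also have "\<dots> = (\<Sum>i<n. card (U i))"
    by (rule card_SigmaI) (auto simp: U_def)
  also have "\<dots> = (\<Sum>i<n. (if i = x then t i else 0) + (if a i = x then H - t i else 0))"
  proof (rule sum.cong[OF refl])
    fix i assume "i \<in> {..<n}"
    then have "t i < H" using t by auto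
    have "U i = (if i = x then {..<t i} else {}) \<union> (if a i = x then {t i..<H} else {})"
      using \<open>t i < H\<close> by (auto simp: U_def split: if_splits)
    then show "card (U i) = (if i = x then t i else 0) + (if a i = x then H - t i else 0)"
      by (auto intro: card_Un_disjoint[THEN trans])
  qed
  also have "\<dots> = t x + (\<Sum>i | i < n \<and> a i = x. H - t i)"
    using x by (simp add: sum.distrib sum.If_cases Int_def)
  finally show ?thesis .
qed


section \<open>Running programs\<close>

definition straight :: "'r instr list \<Rightarrow> 'r prog" where
  "straight is = foldr (\<lambda>i. Seq (Do i)) is Skip"

lemma exec_straight:
  "exec \<omega> lab obin s (straight is) \<sigma> (sum_list (map cost is)) (fold (step \<omega> lab obin s) is \<sigma>)"
  by (induction "is" arbitrary: \<sigma>) (auto simp: straight_def intro: exec.intros)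

lemma regs_straight: "regs (straight is) = (\<Union>i\<in>set is. instr_regs i)"
  by (induction "is") (auto simp: straight_def)

text \<open>The step count is forgotten because preprocessing carries no time bound.\<close>

definition runs_to ::
  "nat \<Rightarrow> (nat \<Rightarrow> 'a) \<Rightarrow> ('a \<Rightarrow> nat \<Rightarrow> bool list) \<Rightarrow> (nat \<Rightarrow> bool) \<Rightarrow>
   nat prog \<Rightarrow> 'a state \<Rightarrow> ('a state \<Rightarrow> bool) \<Rightarrow> bool" where
  "runs_to \<omega> lab obin s P \<sigma> Q \<longleftrightarrow> (\<exists>t \<sigma>'. exec \<omega> lab obin s P \<sigma> t \<sigma>' \<and> Q \<sigma>')"

lemma runs_to_Do_Seq:
  "runs_to \<omega> lab obin s P (step \<omega> lab obin s i \<sigma>) Q \<Longrightarrow> runs_to \<omega> lab obin s (Seq (Do i) P) \<sigma> Q"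
  unfolding runs_to_def by (blast intro: exec.Do exec.Seq)

lemma runs_to_straight:
  "Q (fold (step \<omega> lab obin s) is \<sigma>) \<Longrightarrow> runs_to \<omega> lab obin s (straight is) \<sigma> Q"
  unfolding runs_to_def using exec_straight by blast

lemma runs_to_If:
  "runs_to \<omega> lab obin s (if reg \<sigma> r \<noteq> 0 then P else P') \<sigma> Q \<Longrightarrow>
     runs_to \<omega> lab obin s (If r P P') \<sigma> Q"
  unfolding runs_to_def by (cases "reg \<sigma> r = 0") (auto intro: exec.If_True exec.If_False)


section \<open>Preprocessing\<close>

text \<open>Continuation style: the bits read are remembered only by the position in the decision
  tree. The leaf reached through \<open>bs\<close> runs \<open>K bs\<close>, a program built for
  that particular list.\<close>

primrec read_bits :: "nat \<Rightarrow> (bool list \<Rightarrow> nat prog) \<Rightarrow> nat prog" where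
  "read_bits 0 K = K []"
| "read_bits (Suc n) K = Seq (Do (Next_Bit 0))
     (If 0 (read_bits n (\<lambda>bs. K (True # bs))) (read_bits n (\<lambda>bs. K (False # bs))))"

lemma regs_read_bits:
  assumes "0 \<in> R" "\<And>bs. regs (K bs) \<subseteq> R"
  shows "regs (read_bits n K) \<subseteq> R"
  using assms(2) by (induction n arbitrary: K) (auto simp: assms(1))

lemma runs_to_read_bits:
  assumes "length (reply \<sigma>) = n"
    and "\<And>\<sigma>'. mem \<sigma>' = mem \<sigma> \<Longrightarrow> used \<sigma>' = used \<sigma> \<Longrightarrow> runs_to \<omega> lab obin s (K (reply \<sigma>)) \<sigma>' Q"
  shows "runs_to \<omega> lab obin s (read_bits n K) \<sigma> Q"
  using assms
proof (induction n arbitrary: K \<sigma>)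
  case 0
  then show ?case by auto
next
  case (Suc n)
  then obtain b bs where b: "reply \<sigma> = b # bs" "length bs = n"
    by (auto simp: length_Suc_conv)
  let ?\<sigma> = "step \<omega> lab obin s (Next_Bit 0) \<sigma>"
  have \<sigma>: "reply ?\<sigma> = bs" "mem ?\<sigma> = mem \<sigma>" "used ?\<sigma> = used \<sigma>" "reg ?\<sigma> 0 = of_bool b"
    by (auto simp: set_reg_def b)
  have "runs_to \<omega> lab obin s (read_bits n (\<lambda>bs. K (b # bs))) ?\<sigma> Q"
    using \<sigma> b Suc.prems by (intro Suc.IH) auto
  then show ?case
    using \<sigma>(4) by (cases b) (auto intro!: runs_to_Do_Seq runs_to_If)
qed

text \<open>The query length may exceed one word, hence the two registers 1 and 2;
  \<open>entry_bits_less_two_words\<close> shows that two words suffice.\<close>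

primrec query_all ::
  "nat \<Rightarrow> nat \<Rightarrow> nat list \<Rightarrow> (bool list list \<Rightarrow> nat prog) \<Rightarrow> nat prog" where
  "query_all \<omega> L [] K = K []"
| "query_all \<omega> L (x # xs) K =
     Seq (Do (Const 0 x)) (Seq (Do (Const 1 (L mod 2 ^ \<omega>))) (Seq (Do (Const 2 (L div 2 ^ \<omega>)))
       (Seq (Do (Ask_Bin 0 [1, 2]))
         (read_bits L (\<lambda>bs. query_all \<omega> L xs (\<lambda>bss. K (bs # bss)))))))"

lemma regs_query_all:
  assumes "{0, 1, 2} \<subseteq> R" "\<And>bss. regs (K bss) \<subseteq> R"
  shows "regs (query_all \<omega> L xs K) \<subseteq> R"
  using assms(2)
proof (induction xs arbitrary: K)
  case (Cons x xs)
  have "regs (read_bits L (\<lambda>bs. query_all \<omega> L xs (\<lambda>bss. K (bs # bss)))) \<subseteq> R"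
    using Cons assms(1) by (intro regs_read_bits Cons.IH) auto
  then show ?case using assms(1) by simp
qed auto

lemma runs_to_query_all:
  assumes "\<forall>x\<in>set xs. x < 2 ^ \<omega> \<and> length (obin (lab x) L) = L" "L < 2 ^ \<omega> * 2 ^ \<omega>"
    and "\<And>\<sigma>'. mem \<sigma>' = mem \<sigma> \<Longrightarrow> used \<sigma>' = used \<sigma> \<Longrightarrow>
           runs_to \<omega> lab obin s (K (map (\<lambda>x. obin (lab x) L) xs)) \<sigma>' Q"
  shows "runs_to \<omega> lab obin s (query_all \<omega> L xs K) \<sigma> Q"
  using assms(1,3)
proof (induction xs arbitrary: K \<sigma>)
  case Nil
  then show ?case by simp
next
  case (Cons x xs)
  have L: "L div 2 ^ \<omega> mod 2 ^ \<omega> = L div 2 ^ \<omega>"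
    using assms(2) by (simp add: less_mult_imp_div_less)
  show ?case
    unfolding query_all.simps
    apply (intro runs_to_Do_Seq runs_to_read_bits)
    subgoal using Cons.prems(1) L by (simp add: set_reg_def)
    subgoal for \<sigma>'
      using Cons.prems L by (intro Cons.IH) (auto simp: set_reg_def)
    done
qed

section \<open>Writing a precomputed table into memory\<close>

definition write_words :: "nat \<Rightarrow> bool list \<Rightarrow> nat \<Rightarrow> nat instr list" where
  "write_words \<omega> M n = concat (map (\<lambda>a. [Const 0 a, Const 1 (load_word \<omega> M a), Store 0 1]) [0..<n])"

text \<open>Memory is viewed as one little-endian number, so that word loads, unaligned reads and
  table entries all become bit slices of it.\<close>

lemma load_word_eq:
  "load_word \<omega> M a = take_bit \<omega> (drop_bit (a * \<omega>) (horner_sum of_bool 2 M))"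
  unfolding load_word_def
  by (rule bit_eqI)
    (auto simp: bit_horner_sum_bit_iff bit_take_bit_iff bit_drop_bit_eq ac_simps less_diff_conv)

lemma fold_write_words:
  fixes \<sigma> :: "'a state"
  assumes "\<omega> \<ge> 1" "length (mem \<sigma>) = length M" "n \<le> 2 ^ \<omega>"
  shows "mem (fold (step \<omega> lab obin s) (write_words \<omega> M n) \<sigma>) =
           map (\<lambda>p. if p < n * \<omega> then M ! p else mem \<sigma> ! p) [0..<length M] \<and>
         used (fold (step \<omega> lab obin s) (write_words \<omega> M n) \<sigma>) = used \<sigma>"
  using assms(3)
proof (induction n)
  case 0
  then show ?case by (simp add: write_words_def map_nth assms(2)[symmetric])
next
  case (Suc n)
  have w: "write_words \<omega> M (Suc n) =
      write_words \<omega> M n @ [Const 0 n, Const 1 (load_word \<omega> M n), Store 0 1]"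
    by (simp add: write_words_def)
  have div_iff: "p div \<omega> = n \<longleftrightarrow> n * \<omega> \<le> p \<and> p < n * \<omega> + \<omega>" for p
    using assms(1) by (auto simp: div_nat_eqI mult.commute) (metis add.commute assms(1) div_mult_mod_eq less_eq_Suc_le mod_less_divisor mult.commute nat_add_left_cancel_less One_nat_def)
  have bits: "bit (load_word \<omega> M n) (p mod \<omega>) = M ! p" if "p div \<omega> = n" "p < length M" for p
  proof -
    have "n * \<omega> + p mod \<omega> = p" using that(1) by auto
    moreover have "p mod \<omega> < \<omega>" using assms(1) by simp
    ultimately show ?thesis
      using that(2) by (simp add: load_word_eq bit_take_bit_iff bit_drop_bit_eq bit_horner_sum_bit_iff)
  qed
  have "load_word \<omega> M n < 2 ^ \<omega>" by (simp add: load_word_eq)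
  then show ?case
    using Suc bits unfolding w fold_append
    by (auto simp: set_reg_def store_word_def div_iff)
qed

text \<open>Storing to all \<open>2 ^ \<omega>\<close> addresses covers every memory of at most
  \<open>\<omega> * 2 ^ \<omega>\<close> bits; a store beyond the end changes nothing.\<close>

definition prep_prog :: "nat \<Rightarrow> nat \<Rightarrow> nat \<Rightarrow> (bool list list \<Rightarrow> bool list) \<Rightarrow> nat prog" where
  "prep_prog \<omega> L m tab = query_all \<omega> L [1..<m] (\<lambda>bss. straight (write_words \<omega> (tab bss) (2 ^ \<omega>)))"

lemma regs_prep_prog: "regs (prep_prog \<omega> L m tab) \<subseteq> {..<3}"
  unfolding prep_prog_def
  by (rule regs_query_all) (auto simp: regs_straight write_words_def)

lemma exec_prep_prog:
  assumes "\<omega> \<ge> 1" "m \<le> 2 ^ \<omega>" "L < 2 ^ \<omega> * 2 ^ \<omega>" "length M \<le> \<omega> * 2 ^ \<omega>"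
    and "\<And>x. 1 \<le> x \<Longrightarrow> x < m \<Longrightarrow> length (obin (lab x) L) = L"
    and "M = tab (map (\<lambda>x. obin (lab x) L) [1..<m])"
  shows "\<exists>t \<sigma>. exec \<omega> lab obin s (prep_prog \<omega> L m tab) (init_state (replicate (length M) False)) t \<sigma> \<and>
           mem \<sigma> = M \<and> used \<sigma> = 0"
  unfolding runs_to_def[symmetric] prep_prog_def
proof (rule runs_to_query_all)
  fix \<sigma> :: "'a state"
  assume "mem \<sigma> = mem (init_state (replicate (length M) False) :: 'a state)"
    "used \<sigma> = used (init_state (replicate (length M) False) :: 'a state)"
  then have \<sigma>: "length (mem \<sigma>) = length M" "used \<sigma> = 0"
    by (auto simp: init_state_def)
  have "map (\<lambda>p. if p < 2 ^ \<omega> * \<omega> then M ! p else mem \<sigma> ! p) [0..<length M] = M"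
    using assms(4) by (intro nth_equalityI) (auto simp: mult.commute)
  then show "runs_to \<omega> lab obin s
      (straight (write_words \<omega> (tab (map (\<lambda>x. obin (lab x) L) [1..<m])) (2 ^ \<omega>))) \<sigma>
      (\<lambda>\<sigma>. mem \<sigma> = M \<and> used \<sigma> = 0)"
    using fold_write_words[OF assms(1) \<sigma>(1) order.refl, of lab obin s] \<sigma>(2)
    unfolding assms(6)[symmetric] by (intro runs_to_straight) simp
qed (use assms in auto)


section \<open>Sampling\<close>

text \<open>Unaligned read into register 5 of bits that may straddle two words. Register 2 holds the
  word index and is advanced for the next read; register 3 holds the offset and register 4 its
  complement to \<open>\<omega>\<close>. At offset 0 the second word is shifted out
  entirely.\<close>

definition fetch :: "nat \<Rightarrow> nat instr list" where
  "fetch len = [Load 5 2, Const 7 1, Op Add 2 2 7, Load 6 2, Op Shr 5 5 3, Op Shl 6 6 4, Op Or 5 5 6,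
     Const 7 (2 ^ len - 1), Op And 5 5 7]"

text \<open>The bit address \<open>i * L\<close> of an entry may exceed a word, so its word index (register 2) and its
  offset in the word (register 3) are computed from the quotients and remainders of \<open>i\<close> and \<open>L\<close>
  modulo \<open>\<omega>\<close>.\<close>

definition sample_start :: "nat \<Rightarrow> nat \<Rightarrow> nat \<Rightarrow> nat instr list" where
  "sample_start \<omega> k L =
    [Rand 0 L, Const 7 (2 ^ k - 1), Op And 1 0 7, Const 7 \<omega>, Op Mod 5 1 7, Op Div 2 1 7,
     Const 10 (L mod \<omega>), Op Mul 5 5 10, Op Mul 2 2 10, Op Mod 3 5 7, Op Div 5 5 7, Op Add 2 2 5,
     Const 10 (L div \<omega>), Op Mul 5 1 10, Op Add 2 2 5, Op Sub 4 7 3]"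

text \<open>Column and alias lie within the first word because \<open>k \<le> \<omega>\<close>.
  Register 9 keeps the alias; both words are then shifted by \<open>k\<close>, so that only height
  and threshold are compared.\<close>

definition sample_first :: "nat \<Rightarrow> nat \<Rightarrow> nat \<Rightarrow> nat instr list" where
  "sample_first \<omega> k L = fetch (min \<omega> L) @
    [Const 7 (2 ^ k - 1), Op And 9 5 7, Const 7 k, Op Shr 5 5 7, Op Shr 0 0 7, Op Lt 8 0 5]"

definition sample_next :: "nat \<Rightarrow> nat \<Rightarrow> nat \<Rightarrow> nat instr list" where
  "sample_next \<omega> L j = Rand 0 (L - j * \<omega>) # fetch (min \<omega> (L - j * \<omega>)) @
    [Op Lt 10 0 5, Op Eq 11 0 5, Op And 8 8 11, Op Or 8 8 10]"

text \<open>Column and alias are selected by multiplication with the comparison bit and its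
  complement, so no branch can reveal the choice through the running time.\<close>

definition sample_end :: "nat instr list" where
  "sample_end = [Op Mul 1 1 8, Const 7 1, Op Sub 8 7 8, Op Mul 9 9 8, Op Add 1 1 9, Emit 1]"

text \<open>If \<open>\<omega>\<close> divides \<open>L\<close>, the last round handles zero bits:
  both words are 0, hence equal, and the comparison is kept.\<close>

definition sample_prog :: "nat \<Rightarrow> nat \<Rightarrow> nat \<Rightarrow> nat prog" where
  "sample_prog \<omega> k L = straight (sample_start \<omega> k L @ sample_first \<omega> k L @
     concat (map (sample_next \<omega> L) [1..<Suc (L div \<omega>)]) @ sample_end)"

lemmas sample_defs = fetch_def sample_start_def sample_first_def sample_next_def sample_end_def

lemma regs_sample_prog: "regs (sample_prog \<omega> k L) \<subseteq> {..<12}"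
  by (auto simp: sample_prog_def regs_straight sample_defs)

text \<open>The start costs 16, the first word 15, the end 6, and each further word 14.\<close>

lemma cost_sample:
  "sum_list (map cost (sample_start \<omega> k L @ sample_first \<omega> k L @
     concat (map (sample_next \<omega> L) [1..<Suc (L div \<omega>)]) @ sample_end)) = 37 + 14 * (L div \<omega>)"
proof -
  have "sum_list (map cost (concat (map (sample_next \<omega> L) [1..<Suc n]))) = 14 * n" for n
    by (induction n) (auto simp: sample_next_def fetch_def)
  then show ?thesis by (simp add: sample_defs)
qed

section \<open>Symbolic evaluation of instruction lists\<close>

lemma mask_mod: "len \<le> \<omega> \<Longrightarrow> (2 ^ len - 1) mod 2 ^ \<omega> = (2 ^ len - 1 :: nat)"
  using power_increasing[of len \<omega> "2::nat"] zero_less_power[of "2::nat" len]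
  by (intro mod_less) linarith

lemma and_mask: "Bit_Operations.and x (2 ^ len - 1) = take_bit len (x::nat)"
  by (simp add: take_bit_eq_mask mask_eq_exp_minus_1)

lemma reg_step:
  "reg (step \<omega> lab obin s (Const d v) \<sigma>) = (reg \<sigma>)(d := v mod 2 ^ \<omega>)"
  "reg (step \<omega> lab obin s (Op f d a b) \<sigma>) = (reg \<sigma>)(d := eval_binop \<omega> f (reg \<sigma> a) (reg \<sigma> b))"
  "reg (step \<omega> lab obin s (Rand d n) \<sigma>) =
     (reg \<sigma>)(d := horner_sum of_bool 2 (map s [used \<sigma>..<used \<sigma> + min n \<omega>]))"
  by (simp_all add: set_reg_def)

lemma mem_step: "\<forall>a v. i \<noteq> Store a v \<Longrightarrow> mem (step \<omega> lab obin s i \<sigma>) = mem \<sigma>"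
  by (cases i) (auto simp: set_reg_def)

lemma used_step: "\<forall>d n. i \<noteq> Rand d n \<Longrightarrow> used (step \<omega> lab obin s i \<sigma>) = used \<sigma>"
  by (cases i) (auto simp: set_reg_def)

lemma result_step_Emit: "result (step \<omega> lab obin s (Emit r) \<sigma>) = Some (lab (reg \<sigma> r))"
  by simp

lemmas eval_simps = fold_simps reg_step fun_upd_apply eval_binop.simps rel_simps simp_thms if_True if_False

text \<open>Bit \<open>n\<close> comes from the first word if \<open>off + n < \<omega>\<close> and
  from the second otherwise. Register 2 is known only modulo \<open>2 ^ \<omega>\<close>; by
  \<open>fits\<close>, every word that contributes a wanted bit has an index below
  \<open>2 ^ \<omega>\<close>, so a wrapped address is harmless.\<close>

lemma fold_fetch:
  fixes \<sigma> :: "'a state" and \<omega> A off len :: nat and lab obin s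
  defines "\<sigma>' \<equiv> fold (step \<omega> lab obin s) (fetch len) \<sigma>"
  assumes "len \<le> \<omega>" "reg \<sigma> 2 = A mod 2 ^ \<omega>" "reg \<sigma> 3 = off" "reg \<sigma> 4 = \<omega> - off" "off < \<omega>"
    and fits: "A * \<omega> + off + len \<le> \<omega> * 2 ^ \<omega>"
  shows "reg \<sigma>' 5 = take_bit len (drop_bit (A * \<omega> + off) (horner_sum of_bool 2 (mem \<sigma>)))"
    and "reg \<sigma>' 2 = Suc A mod 2 ^ \<omega>"
    and "\<And>r. r \<notin> {2, 5, 6, 7} \<Longrightarrow> reg \<sigma>' r = reg \<sigma> r"
    and "mem \<sigma>' = mem \<sigma>" "used \<sigma>' = used \<sigma>"
proof -
  let ?E = "horner_sum of_bool 2 (mem \<sigma>) :: nat"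
  let ?w = "\<lambda>a. load_word \<omega> (mem \<sigma>) a"
  have one: "Suc 0 mod 2 ^ \<omega> = Suc 0" using assms by simp
  have reg': "reg \<sigma>' = (reg \<sigma>)
      (2 := (A mod 2 ^ \<omega> + 1) mod 2 ^ \<omega>,
       6 := (?w ((A mod 2 ^ \<omega> + 1) mod 2 ^ \<omega>) * 2 ^ (\<omega> - off)) mod 2 ^ \<omega>,
       5 := take_bit len (Bit_Operations.or (?w (A mod 2 ^ \<omega>) div 2 ^ off)
         ((?w ((A mod 2 ^ \<omega> + 1) mod 2 ^ \<omega>) * 2 ^ (\<omega> - off)) mod 2 ^ \<omega>)),
       7 := 2 ^ len - 1)"
    unfolding \<sigma>'_def fetch_def using assms(2-5) one mask_mod[OF assms(2)] and_mask
    by (auto simp: set_reg_def fun_eq_iff)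
  show "mem \<sigma>' = mem \<sigma>" "used \<sigma>' = used \<sigma>"
    unfolding \<sigma>'_def fetch_def by (auto simp: set_reg_def)
  show "reg \<sigma>' r = reg \<sigma> r" if "r \<notin> {2, 5, 6, 7}" for r
    using that by (simp add: reg')
  show "reg \<sigma>' 2 = Suc A mod 2 ^ \<omega>"
    by (simp add: reg' mod_Suc_eq)
  show "reg \<sigma>' 5 = take_bit len (drop_bit (A * \<omega> + off) ?E)"
  proof (rule bit_eqI)
    fix n
    show "bit (reg \<sigma>' 5) n = bit (take_bit len (drop_bit (A * \<omega> + off) ?E)) n"
    proof (cases "n < len")
      case False
      then show ?thesis by (simp add: reg' bit_take_bit_iff bit_or_iff)
    next
      case True
      then have An: "A * \<omega> + (off + n) < 2 ^ \<omega> * \<omega>" using fits by (simp add: mult.commute)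
      have A: "A < 2 ^ \<omega>"
      proof -
        have "A * \<omega> < 2 ^ \<omega> * \<omega>" using An by linarith
        then show ?thesis by simp
      qed
      have A1: "(A mod 2 ^ \<omega> + 1) mod 2 ^ \<omega> = Suc A" if "\<omega> \<le> off + n"
      proof -
        have "Suc A * \<omega> \<le> A * \<omega> + (off + n)" using that by simp
        then have "Suc A * \<omega> < 2 ^ \<omega> * \<omega>" using An by linarith
        then have "Suc A < 2 ^ \<omega>" by (simp only: mult_less_cancel2)
        then show ?thesis using A by simp
      qed
      \<comment> \<open>The truncation of the left shift to a word is invisible here, since
        \<open>n < len\<close> and \<open>len \<le> \<omega>\<close>.\<close>
      have chunk: "bit (take_bit len (Bit_Operations.or (x div 2 ^ off) (y * 2 ^ (\<omega> - off) mod 2 ^ \<omega>))) n =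
          (bit x (off + n) \<or> \<omega> - off \<le> n \<and> bit y (n - (\<omega> - off)))" for x y :: nat
        using True assms(2)
        by (simp add: bit_take_bit_iff bit_or_iff flip: drop_bit_eq_div push_bit_eq_mult take_bit_eq_mod)
          (auto simp: bit_drop_bit_eq bit_push_bit_iff bit_take_bit_iff bit_or_iff ac_simps)
      have "bit (reg \<sigma>' 5) n = (bit (?w A) (off + n) \<or>
          \<omega> - off \<le> n \<and> bit (?w ((A mod 2 ^ \<omega> + 1) mod 2 ^ \<omega>)) (n - (\<omega> - off)))"
        using True assms(2) A chunk by (simp only: reg' fun_upd_apply rel_simps if_True if_False mod_less)
      also have "\<dots> = bit ?E (A * \<omega> + off + n)"
      proof (cases "\<omega> \<le> off + n")
        case True
        then have "Suc A * \<omega> + (n - (\<omega> - off)) = A * \<omega> + off + n" using assms(6) by simp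
        moreover have "n - (\<omega> - off) < \<omega>" using \<open>n < len\<close> assms by linarith
        moreover have "\<omega> - off \<le> n" "\<not> off + n < \<omega>" using True by auto
        ultimately show ?thesis unfolding A1[OF True]
          by (simp add: load_word_eq bit_take_bit_iff bit_drop_bit_eq ac_simps)
      next
        case False
        then have "\<not> \<omega> - off \<le> n" by linarith
        with False show ?thesis by (simp add: load_word_eq bit_take_bit_iff bit_drop_bit_eq add.assoc)
      qed
      finally show ?thesis using True by (simp add: bit_take_bit_iff bit_drop_bit_eq)
    qed
  qed
qed

section \<open>Address arithmetic within a word\<close>

lemma Suc_square_less: "n * n < 2 ^ Suc n"
proof (induction n)
  case (Suc n)
  show ?case
  proof (cases "n < 3")
    case True
    then have "n = 0 \<or> n = 1 \<or> n = 2" by auto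
    then show ?thesis by auto
  next
    case False
    then have "3 * n \<le> n * n" by simp
    moreover have "Suc n * Suc n = n * n + 2 * n + 1" by simp
    ultimately have "Suc n * Suc n \<le> 2 * (n * n)" using False by linarith
    then show ?thesis using Suc by simp
  qed
qed auto

text \<open>Allows two remainders modulo \<open>\<omega>\<close> to be multiplied without overflow.
  Strictness matters: \<open>\<omega> * \<omega>\<close> exceeds \<open>2 ^ \<omega>\<close> for
  \<open>\<omega> = 3\<close>.\<close>

lemma less_square_less_exp:
  assumes "a < \<omega>" "b < \<omega>"
  shows "a * b < 2 ^ \<omega>"
proof -
  have "a * b \<le> (\<omega> - 1) * (\<omega> - 1)" using assms by (intro mult_le_mono) auto
  also have "\<dots> < 2 ^ Suc (\<omega> - 1)" by (rule Suc_square_less)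
  finally show ?thesis using assms by simp
qed

definition table_entry :: "bool list \<Rightarrow> nat \<Rightarrow> nat \<Rightarrow> nat" where
  "table_entry M L i = take_bit L (drop_bit (i * L) (horner_sum of_bool 2 M))"

text \<open>The first coin is the least significant bit, matching successive uses of
  \<open>Rand\<close> that deliver words of increasing significance.\<close>

definition coin_num :: "nat \<Rightarrow> (nat \<Rightarrow> bool) \<Rightarrow> nat" where
  "coin_num n s = horner_sum of_bool 2 (map s [0..<n])"

lemma coin_num_less: "coin_num n s < 2 ^ n"
  unfolding coin_num_def using horner_sum_of_bool_2_less[of "map s [0..<n]"] by simp

lemma bit_coin_num: "bit (coin_num n s) j \<longleftrightarrow> j < n \<and> s j"
  unfolding coin_num_def by (auto simp: bit_horner_sum_bit_iff)

text \<open>The words of the random number and of the table entry are compared from the least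
  significant one upwards; register 8 holds the comparison of the first \<open>j\<close> words.\<close>

definition sample_inv ::
  "nat \<Rightarrow> nat \<Rightarrow> nat \<Rightarrow> bool list \<Rightarrow> nat \<Rightarrow> nat \<Rightarrow> 'a state \<Rightarrow> bool" where
  "sample_inv \<omega> k L M v j \<sigma> \<longleftrightarrow>
     (let i = v mod 2 ^ k; e = table_entry M L i in
        mem \<sigma> = M \<and> used \<sigma> = min (j * \<omega>) L \<and>
        reg \<sigma> 1 = i \<and> reg \<sigma> 9 = e mod 2 ^ k \<and>
        reg \<sigma> 2 = (i * L div \<omega> + j) mod 2 ^ \<omega> \<and>
        reg \<sigma> 3 = i * L mod \<omega> \<and> reg \<sigma> 4 = \<omega> - i * L mod \<omega> \<and>
        reg \<sigma> 8 = of_bool (take_bit (j * \<omega>) v div 2 ^ k < take_bit (j * \<omega>) e div 2 ^ k))"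

text \<open>Splitting \<open>L\<close> and then \<open>i\<close> into quotient and remainder modulo
  \<open>\<omega>\<close> turns everything except the product of the two remainders into a visible
  multiple of \<open>\<omega>\<close>.\<close>

lemma address:
  fixes i L :: nat
  assumes "\<omega> \<ge> 1"
  shows "i * L div \<omega> = i div \<omega> * (L mod \<omega>) + i mod \<omega> * (L mod \<omega>) div \<omega> + i * (L div \<omega>)"
    and "i * L mod \<omega> = i mod \<omega> * (L mod \<omega>) mod \<omega>"
proof -
  have "i * L = i * (L mod \<omega> + \<omega> * (L div \<omega>))" by simp
  also have "\<dots> = i * (L mod \<omega>) + \<omega> * (i * (L div \<omega>))" by (simp only: algebra_simps)
  also have "i * (L mod \<omega>) = (i mod \<omega> + \<omega> * (i div \<omega>)) * (L mod \<omega>)" by simp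
  also have "\<dots> = i mod \<omega> * (L mod \<omega>) + \<omega> * (i div \<omega> * (L mod \<omega>))" by (simp only: algebra_simps)
  finally have "i * L = i mod \<omega> * (L mod \<omega>) + \<omega> * (i div \<omega> * (L mod \<omega>) + i * (L div \<omega>))"
    by (simp only: algebra_simps)
  then show "i * L div \<omega> = i div \<omega> * (L mod \<omega>) + i mod \<omega> * (L mod \<omega>) div \<omega> + i * (L div \<omega>)"
    using assms by simp
qed (simp add: mod_mult_eq)

lemma fold_sample_start:
  fixes \<omega> k L :: nat and lab :: "nat \<Rightarrow> 'a" and M obin s
  assumes "\<omega> \<ge> 1" "k \<le> \<omega>" "k \<le> L"
  defines "\<sigma> \<equiv> fold (step \<omega> lab obin s) (sample_start \<omega> k L) (init_state M)"
    and "i \<equiv> coin_num L s mod 2 ^ k"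
  shows "mem \<sigma> = M" "used \<sigma> = min \<omega> L" "reg \<sigma> 0 = take_bit \<omega> (coin_num L s)" "reg \<sigma> 1 = i"
    "reg \<sigma> 2 = (i * L div \<omega>) mod 2 ^ \<omega>" "reg \<sigma> 3 = i * L mod \<omega>" "reg \<sigma> 4 = \<omega> - i * L mod \<omega>"
proof -
  have rand: "horner_sum of_bool 2 (map s [used (init_state M :: 'a state)..<used (init_state M :: 'a state) + min L \<omega>]) = take_bit \<omega> (coin_num L s)"
    unfolding init_state_def
    by (rule bit_eqI) (auto simp: bit_horner_sum_bit_iff bit_take_bit_iff bit_coin_num)
  have i: "take_bit k (take_bit \<omega> (coin_num L s)) = i"
    using assms by (simp add: i_def take_bit_eq_mod mod_mod_cancel le_imp_power_dvd)
  \<comment> \<open>This product must be exact because it gets divided by \<open>\<omega>\<close>;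
    the other summands of the word index matter only modulo \<open>2 ^ \<omega>\<close>.\<close>
  have prod: "i mod \<omega> * (L mod \<omega>) mod 2 ^ \<omega> = i mod \<omega> * (L mod \<omega>)"
    using assms by (intro mod_less less_square_less_exp) auto
  have small: "\<omega> mod 2 ^ \<omega> = \<omega>" "L mod \<omega> mod 2 ^ \<omega> = L mod \<omega>"
    using assms less_exp[of \<omega>] by (auto intro!: mod_less less_trans[OF mod_less_divisor])
  have sub: "(\<omega> + 2 ^ \<omega> - x) mod 2 ^ \<omega> = \<omega> - x" if "x < \<omega>" for x
  proof -
    have "\<omega> + 2 ^ \<omega> - x = \<omega> - x + 2 ^ \<omega>" using that by simp
    moreover have "\<omega> - x < 2 ^ \<omega>" using less_exp[of \<omega>] by linarith
    ultimately show ?thesis by (simp only: mod_add_self2 mod_less)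
  qed
  show "mem \<sigma> = M"
    unfolding \<sigma>_def sample_start_def fold_simps by (simp add: mem_step init_state_def del: step.simps)
  show "used \<sigma> = min \<omega> L"
    unfolding \<sigma>_def sample_start_def fold_simps
    by (simp only: used_step instr.distinct simp_thms)
      (simp add: set_reg_def init_state_def min.commute)
  \<comment> \<open>Four stages: the column \<open>i\<close>; its quotient and remainder modulo
    \<open>\<omega>\<close>; their products with \<open>L mod \<omega>\<close>; the offset and the
    carry into the word index.\<close>
  define \<sigma>1 where "\<sigma>1 = fold (step \<omega> lab obin s) [Rand 0 L, Const 7 (2 ^ k - 1), Op And 1 0 7] (init_state M)"
  define \<sigma>2 where "\<sigma>2 = fold (step \<omega> lab obin s) [Const 7 \<omega>, Op Mod 5 1 7, Op Div 2 1 7] \<sigma>1"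
  define \<sigma>3 where "\<sigma>3 = fold (step \<omega> lab obin s) [Const 10 (L mod \<omega>), Op Mul 5 5 10, Op Mul 2 2 10] \<sigma>2"
  define \<sigma>4 where "\<sigma>4 = fold (step \<omega> lab obin s) [Op Mod 3 5 7, Op Div 5 5 7, Op Add 2 2 5] \<sigma>3"
  have \<sigma>: "\<sigma> = fold (step \<omega> lab obin s) [Const 10 (L div \<omega>), Op Mul 5 1 10, Op Add 2 2 5, Op Sub 4 7 3] \<sigma>4"
    by (simp only: \<sigma>_def sample_start_def \<sigma>1_def \<sigma>2_def \<sigma>3_def \<sigma>4_def fold_simps)
  have 1: "reg \<sigma>1 0 = take_bit \<omega> (coin_num L s)" "reg \<sigma>1 1 = i"
    unfolding \<sigma>1_def by (simp_all only: eval_simps rand mask_mod[OF assms(2)] and_mask i)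
  have 2: "reg \<sigma>2 0 = take_bit \<omega> (coin_num L s)" "reg \<sigma>2 1 = i" "reg \<sigma>2 2 = i div \<omega>"
    "reg \<sigma>2 5 = i mod \<omega>" "reg \<sigma>2 7 = \<omega>"
    unfolding \<sigma>2_def by (simp_all only: eval_simps 1 small)
  have 3: "reg \<sigma>3 0 = take_bit \<omega> (coin_num L s)" "reg \<sigma>3 1 = i"
    "reg \<sigma>3 2 = i div \<omega> * (L mod \<omega>) mod 2 ^ \<omega>"
    "reg \<sigma>3 5 = i mod \<omega> * (L mod \<omega>)" "reg \<sigma>3 7 = \<omega>"
    unfolding \<sigma>3_def by (simp_all only: eval_simps 2 small prod)
  have 4: "reg \<sigma>4 0 = take_bit \<omega> (coin_num L s)" "reg \<sigma>4 1 = i"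
    "reg \<sigma>4 2 = (i div \<omega> * (L mod \<omega>) mod 2 ^ \<omega> + i mod \<omega> * (L mod \<omega>) div \<omega>) mod 2 ^ \<omega>"
    "reg \<sigma>4 3 = i * L mod \<omega>" "reg \<sigma>4 7 = \<omega>"
    unfolding \<sigma>4_def by (simp_all only: eval_simps 3 address(2)[OF assms(1), symmetric])
  show "reg \<sigma> 0 = take_bit \<omega> (coin_num L s)" "reg \<sigma> 1 = i" "reg \<sigma> 3 = i * L mod \<omega>"
    unfolding \<sigma> by (simp_all only: eval_simps 4)
  show "reg \<sigma> 4 = \<omega> - i * L mod \<omega>"
    unfolding \<sigma> using assms(1) by (simp only: eval_simps 4) (simp add: sub)
  show "reg \<sigma> 2 = (i * L div \<omega>) mod 2 ^ \<omega>"
    unfolding \<sigma> by (simp only: eval_simps 4 address(1)[OF assms(1), of i L] mod_simps)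
qed

text \<open>The read is cut off at the end of the entry, so no bits of the next entry leak
  in.\<close>

lemma table_entry_chunk:
  "take_bit (min \<omega> (L - j * \<omega>)) (drop_bit (i * L + j * \<omega>) (horner_sum of_bool 2 M)) =
     take_bit \<omega> (drop_bit (j * \<omega>) (table_entry M L i))"
  by (rule bit_eqI)
    (auto simp: table_entry_def bit_take_bit_iff bit_drop_bit_eq less_diff_conv ac_simps)

text \<open>Supplies the hypothesis \<open>fits\<close> of \<open>fold_fetch\<close>: the slice ends
  within entry \<open>i\<close>, which ends at \<open>Suc i * L\<close>.\<close>

lemma entry_fits:
  fixes L k :: nat
  assumes "2 ^ k * L \<le> \<omega> * 2 ^ \<omega>" "i < 2 ^ k" "j * \<omega> \<le> L"
  shows "(i * L div \<omega> + j) * \<omega> + i * L mod \<omega> + min \<omega> (L - j * \<omega>) \<le> \<omega> * 2 ^ \<omega>"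
proof -
  have "(i * L div \<omega> + j) * \<omega> + i * L mod \<omega> = i * L + j * \<omega>"
    by (simp add: algebra_simps)
  moreover have "i * L + j * \<omega> + min \<omega> (L - j * \<omega>) \<le> Suc i * L"
    using assms(3) by auto
  moreover have "Suc i * L \<le> 2 ^ k * L" using assms(2) by (intro mult_le_mono1) simp
  ultimately show ?thesis using assms(1) by linarith
qed

lemma lex_less_iff:
  fixes x y B :: nat
  assumes "x < B" "y < B"
  shows "x + B * u < y + B * w \<longleftrightarrow> u < w \<or> u = w \<and> x < y"
proof (cases u w rule: linorder_cases)
  case less
  then have "B * Suc u \<le> B * w" by (intro mult_le_mono2) simp
  then show ?thesis using less assms by simp
next
  case greater
  then have "B * Suc w \<le> B * u" by (intro mult_le_mono2) simp
  then show ?thesis using greater assms by simp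
qed auto

text \<open>Once the \<open>k\<close> low bits are dropped, a further word enters as a leading digit
  in base \<open>2 ^ (n - k)\<close>; this is the shape that \<open>lex_less_iff\<close>
  compares.\<close>

lemma take_bit_Suc_div:
  fixes x :: nat
  assumes "k \<le> n"
  shows "take_bit (n + len) x div 2 ^ k = take_bit n x div 2 ^ k + 2 ^ (n - k) * take_bit len (drop_bit n x)"
proof -
  have "take_bit (n + len) x = take_bit n x + 2 ^ n * take_bit len (drop_bit n x)"
    by (simp add: take_bit_eq_mod drop_bit_eq_div power_add mod_mult2_eq)
  also have "2 ^ n = 2 ^ k * (2 ^ (n - k) :: nat)"
    using assms by (simp flip: power_add)
  finally show ?thesis by (simp add: mult.assoc)
qed

lemma sample_first_inv:
  fixes \<omega> k L :: nat and lab :: "nat \<Rightarrow> 'a" and M obin s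
  assumes "\<omega> \<ge> 1" "k \<le> \<omega>" "k \<le> L" "2 ^ k * L \<le> \<omega> * 2 ^ \<omega>"
  defines "\<sigma> \<equiv> fold (step \<omega> lab obin s) (sample_start \<omega> k L) (init_state M)"
  shows "sample_inv \<omega> k L M (coin_num L s) 1 (fold (step \<omega> lab obin s) (sample_first \<omega> k L) \<sigma>)"
proof -
  let ?v = "coin_num L s" and ?i = "coin_num L s mod 2 ^ k"
  let ?e = "table_entry M L ?i"
  note start = fold_sample_start[OF assms(1-3), where lab = lab and obin = obin and s = s and M = M, folded \<sigma>_def]
  define \<tau> where "\<tau> = fold (step \<omega> lab obin s) (fetch (min \<omega> L)) \<sigma>"
  have fits: "(?i * L div \<omega>) * \<omega> + ?i * L mod \<omega> + min \<omega> L \<le> \<omega> * 2 ^ \<omega>"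
    using entry_fits[OF assms(4), of ?i 0] by simp
  have off: "?i * L mod \<omega> < \<omega>" using assms(1) by simp
  note fetch = fold_fetch[OF min.cobounded1 start(5,6,7) off fits, where lab = lab and obin = obin and s = s, folded \<tau>_def]
  have "reg \<tau> 5 = take_bit \<omega> ?e"
    using fetch(1) table_entry_chunk[of \<omega> L 0 ?i M] by (simp add: start)
  moreover have "take_bit k (take_bit \<omega> ?e) = ?e mod 2 ^ k"
    using assms by (simp add: take_bit_eq_mod mod_mod_cancel le_imp_power_dvd)
  moreover have "k mod 2 ^ \<omega> = k" using assms(2) less_exp[of \<omega>] by (intro mod_less) linarith
  moreover define \<sigma>' where "\<sigma>' = fold (step \<omega> lab obin s) (sample_first \<omega> k L) \<sigma>"
  have \<sigma>': "\<sigma>' = fold (step \<omega> lab obin s)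
      [Const 7 (2 ^ k - 1), Op And 9 5 7, Const 7 k, Op Shr 5 5 7, Op Shr 0 0 7, Op Lt 8 0 5] \<tau>"
    by (simp only: \<sigma>'_def sample_first_def \<tau>_def fold_append comp_apply)
  ultimately have "reg \<sigma>' 9 = ?e mod 2 ^ k"
    "reg \<sigma>' 8 = of_bool (reg \<tau> 0 div 2 ^ k < take_bit \<omega> ?e div 2 ^ k)"
    unfolding \<sigma>' by (simp_all only: eval_simps mask_mod[OF assms(2)] and_mask)
  moreover have "mem \<sigma>' = mem \<tau>" "used \<sigma>' = used \<tau>"
    unfolding \<sigma>' fold_simps by (simp_all add: mem_step used_step del: step.simps)
  moreover have "reg \<sigma>' 1 = reg \<tau> 1" "reg \<sigma>' 2 = reg \<tau> 2" "reg \<sigma>' 3 = reg \<tau> 3" "reg \<sigma>' 4 = reg \<tau> 4"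
    unfolding \<sigma>' by (simp_all only: eval_simps)
  moreover have "reg \<tau> 0 = reg \<sigma> 0" "reg \<tau> 1 = reg \<sigma> 1" "reg \<tau> 3 = reg \<sigma> 3" "reg \<tau> 4 = reg \<sigma> 4"
    by (rule fetch(3), simp)+
  ultimately show ?thesis
    unfolding sample_inv_def \<sigma>'_def[symmetric] Let_def
    by (simp add: fetch(2,4,5) start start(4)[unfolded One_nat_def])
qed

lemma sample_next_inv:
  fixes \<sigma> :: "'a state"
  assumes "\<omega> \<ge> 1" "k \<le> \<omega>" "k \<le> L" "2 ^ k * L \<le> \<omega> * 2 ^ \<omega>"
    and inv: "sample_inv \<omega> k L M (coin_num L s) j \<sigma>" and j: "j \<ge> 1" "j * \<omega> \<le> L"
  shows "sample_inv \<omega> k L M (coin_num L s) (Suc j) (fold (step \<omega> lab obin s) (sample_next \<omega> L j) \<sigma>)"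
proof -
  let ?v = "coin_num L s" and ?i = "coin_num L s mod 2 ^ k"
  let ?e = "table_entry M L ?i" and ?A = "coin_num L s mod 2 ^ k * L div \<omega> + j"
  note inv = inv[unfolded sample_inv_def Let_def]
  define \<rho> where "\<rho> = step \<omega> lab obin s (Rand 0 (L - j * \<omega>)) \<sigma>"
  have "horner_sum of_bool 2 (map s [j * \<omega>..<j * \<omega> + min (L - j * \<omega>) \<omega>]) =
      take_bit \<omega> (drop_bit (j * \<omega>) ?v)"
    by (rule bit_eqI) (auto simp: bit_horner_sum_bit_iff bit_take_bit_iff bit_drop_bit_eq bit_coin_num)
  then have \<rho>: "reg \<rho> 0 = take_bit \<omega> (drop_bit (j * \<omega>) ?v)" "mem \<rho> = M"
      "used \<rho> = min (Suc j * \<omega>) L" "\<And>r. r \<noteq> 0 \<Longrightarrow> reg \<rho> r = reg \<sigma> r"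
    using inv j(2) by (auto simp: \<rho>_def set_reg_def min_absorb1)
  define \<tau> where "\<tau> = fold (step \<omega> lab obin s) (fetch (min \<omega> (L - j * \<omega>))) \<rho>"
  have fits: "?A * \<omega> + ?i * L mod \<omega> + min \<omega> (L - j * \<omega>) \<le> \<omega> * 2 ^ \<omega>"
    using entry_fits[OF assms(4) _ j(2), of ?i] by simp
  have off: "?i * L mod \<omega> < \<omega>" using assms(1) by simp
  have r: "reg \<rho> 2 = ?A mod 2 ^ \<omega>" "reg \<rho> 3 = ?i * L mod \<omega>" "reg \<rho> 4 = \<omega> - ?i * L mod \<omega>"
    using \<rho>(4) inv by auto
  note fetch = fold_fetch[OF min.cobounded1 r off fits, where lab = lab and obin = obin and s = s, folded \<tau>_def]
  have "?A * \<omega> + ?i * L mod \<omega> = ?i * L + j * \<omega>" by (simp add: algebra_simps)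
  then have 5: "reg \<tau> 5 = take_bit \<omega> (drop_bit (j * \<omega>) ?e)"
    using fetch(1) table_entry_chunk[of \<omega> L j ?i M] by (simp add: \<rho>(2))
  \<comment> \<open>Since \<open>j \<ge> 1\<close>, the \<open>k\<close> discarded bits lie in the
    part already processed.\<close>
  have kj: "k \<le> j * \<omega>"
    using assms(2) j(1) by (metis le_trans mult_le_mono1 mult_1)
  have B: "take_bit (j * \<omega>) x div 2 ^ k < 2 ^ (j * \<omega> - k)" for x :: nat
    using kj by (auto simp: less_mult_imp_div_less simp flip: power_add)
  \<comment> \<open>The new word is more significant, so it decides unless the two words
    agree.\<close>
  have cmp: "take_bit (Suc j * \<omega>) ?v div 2 ^ k < take_bit (Suc j * \<omega>) ?e div 2 ^ k \<longleftrightarrow>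
      reg \<rho> 0 < reg \<tau> 5 \<or> reg \<rho> 0 = reg \<tau> 5 \<and>
        take_bit (j * \<omega>) ?v div 2 ^ k < take_bit (j * \<omega>) ?e div 2 ^ k"
    unfolding mult_Suc add.commute[of \<omega>] take_bit_Suc_div[OF kj] lex_less_iff[OF B B] \<rho>(1) 5 ..
  have other: "reg \<tau> r = reg \<sigma> r" if "r \<notin> {0, 2, 5, 6, 7}" for r
    using that fetch(3) \<rho>(4) by simp
  define \<sigma>' where "\<sigma>' = fold (step \<omega> lab obin s) (sample_next \<omega> L j) \<sigma>"
  have \<sigma>': "\<sigma>' = fold (step \<omega> lab obin s) [Op Lt 10 0 5, Op Eq 11 0 5, Op And 8 8 11, Op Or 8 8 10] \<tau>"
    by (simp only: \<sigma>'_def sample_next_def \<rho>_def \<tau>_def fold_simps fold_append comp_apply)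
  have "reg \<sigma>' 8 = Bit_Operations.or (Bit_Operations.and (reg \<tau> 8) (of_bool (reg \<tau> 0 = reg \<tau> 5)))
      (of_bool (reg \<tau> 0 < reg \<tau> 5))" "mem \<sigma>' = mem \<tau>" "used \<sigma>' = used \<tau>"
    unfolding \<sigma>' by (simp_all add: set_reg_def)
  moreover have "reg \<sigma>' r = reg \<tau> r" if "r \<notin> {8, 10, 11}" for r
    using that unfolding \<sigma>' by (simp add: set_reg_def)
  moreover have "reg \<tau> 0 = reg \<rho> 0" "reg \<tau> 2 = Suc ?A mod 2 ^ \<omega>" "mem \<tau> = M" "used \<tau> = min (Suc j * \<omega>) L"
    using fetch \<rho>(2,3) by simp_all
  moreover have "Bit_Operations.or (Bit_Operations.and (of_bool p) (of_bool q)) (of_bool r) =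
      (of_bool (r \<or> q \<and> p) :: nat)" for p q r
    by (cases p; cases q; cases r) simp_all
  ultimately show ?thesis
    unfolding sample_inv_def \<sigma>'_def[symmetric] Let_def cmp
    using inv other by (simp del: mult_Suc)
qed

lemma exec_sample_prog:
  fixes lab :: "nat \<Rightarrow> 'a"
  assumes "\<omega> \<ge> 1" "k \<le> \<omega>" "k \<le> L" "2 ^ k * L \<le> \<omega> * 2 ^ \<omega>"
  shows "\<exists>\<sigma>. exec \<omega> lab obin s (sample_prog \<omega> k L) (init_state M) (37 + 14 * (L div \<omega>)) \<sigma> \<and>
      mem \<sigma> = M \<and> used \<sigma> = L \<and>
      result \<sigma> = Some (lab (alias_sample (2 ^ k) (\<lambda>i. table_entry M L i div 2 ^ k)
        (\<lambda>i. table_entry M L i mod 2 ^ k) (coin_num L s)))"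
proof -
  let ?run = "\<lambda>is. fold (step \<omega> lab obin s) is"
  let ?v = "coin_num L s" and ?i = "coin_num L s mod 2 ^ k"
  let ?e = "table_entry M L ?i"
  define \<sigma>0 :: "'a state" where
    "\<sigma>0 = ?run (sample_first \<omega> k L) (?run (sample_start \<omega> k L) (init_state M))"
  have "n * \<omega> \<le> L \<Longrightarrow>
      sample_inv \<omega> k L M ?v (Suc n) (?run (concat (map (sample_next \<omega> L) [1..<Suc n])) \<sigma>0)" for n
  proof (induction n)
    case 0
    then show ?case using sample_first_inv[OF assms] by (simp add: \<sigma>0_def)
  next
    case (Suc n)
    then show ?case
      using sample_next_inv[OF assms, of M s "Suc n" _ lab obin] by (simp del: upt_Suc add: upt_Suc_append)
  qed
  note this[of "L div \<omega>"]
  moreover define \<sigma> where "\<sigma> = ?run (concat (map (sample_next \<omega> L) [1..<Suc (L div \<omega>)])) \<sigma>0"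
  ultimately have inv: "sample_inv \<omega> k L M ?v (Suc (L div \<omega>)) \<sigma>" by simp
  \<comment> \<open>All \<open>L\<close> bits have now been covered, so the truncations in the
    invariant disappear.\<close>
  have "L < Suc (L div \<omega>) * \<omega>" using assms(1) dividend_less_div_times[of \<omega> L] by simp
  then have used: "min (Suc (L div \<omega>) * \<omega>) L = L" and le: "(2::nat) ^ L \<le> 2 ^ (Suc (L div \<omega>) * \<omega>)"
    by (auto intro!: power_increasing)
  have full: "take_bit (Suc (L div \<omega>) * \<omega>) x = x" if "x < 2 ^ L" for x :: nat
    using that le by (intro take_bit_nat_eq_self) (rule order.strict_trans2)
  have "?e < 2 ^ L" by (simp add: table_entry_def)
  note inv = inv[unfolded sample_inv_def Let_def used full[OF this] full[OF coin_num_less]]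
  have small: "x mod 2 ^ k mod 2 ^ \<omega> = x mod 2 ^ k" for x :: nat
    using assms(2) by (intro mod_less order.strict_trans2[OF mod_less_divisor power_increasing]) auto
  let ?prog = "sample_start \<omega> k L @ sample_first \<omega> k L @
     concat (map (sample_next \<omega> L) [1..<Suc (L div \<omega>)]) @ sample_end"
  have "?run sample_end \<sigma> = ?run ?prog (init_state M)"
    by (simp only: \<sigma>_def \<sigma>0_def fold_append comp_apply)
  then have "exec \<omega> lab obin s (sample_prog \<omega> k L) (init_state M) (37 + 14 * (L div \<omega>)) (?run sample_end \<sigma>)"
    unfolding sample_prog_def using exec_straight[of \<omega> lab obin s ?prog "init_state M"]
    by (simp only: cost_sample)
  moreover have "mem (?run sample_end \<sigma>) = M" "used (?run sample_end \<sigma>) = L"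
    using inv unfolding sample_end_def fold_simps by (simp_all add: mem_step used_step del: step.simps)
  moreover have "result (?run sample_end \<sigma>) = Some (lab (alias_sample (2 ^ k)
      (\<lambda>i. table_entry M L i div 2 ^ k) (\<lambda>i. table_entry M L i mod 2 ^ k) ?v))"
  proof -
    let ?b = "?v div 2 ^ k < ?e div 2 ^ k"
    have one: "1 mod 2 ^ \<omega> = (1::nat)" "(1 + 2 ^ \<omega>) mod 2 ^ \<omega> = (1::nat)"
      using assms(1) by (simp_all only: mod_add_self2) (auto intro!: mod_less one_less_power)
    \<comment> \<open>At most one product is nonzero and both candidates are below
      \<open>2 ^ k\<close>, so nothing overflows.\<close>
    have "result (?run sample_end \<sigma>) = Some (lab ((?i * of_bool ?b mod 2 ^ \<omega> +
        ?e mod 2 ^ k * ((1 + 2 ^ \<omega> - of_bool ?b) mod 2 ^ \<omega>) mod 2 ^ \<omega>) mod 2 ^ \<omega>))"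
      unfolding sample_end_def using inv by (simp only: eval_simps result_step_Emit one)
    also have "\<dots> = Some (lab (if ?b then ?i else ?e mod 2 ^ k))"
      using one by (cases ?b) (simp_all add: small)
    finally show ?thesis by (simp add: alias_sample_def)
  qed
  ultimately show ?thesis by blast
qed


section \<open>Coins\<close>

lemma prob_space_coins: "prob_space coins"
  unfolding coins_def by (intro prob_space_PiM) (rule prob_space_measure_pmf)

lemma space_coins: "space coins = UNIV"
  by (simp add: coins_def space_PiM)

lemma coin_measurable: "(\<lambda>s. s i) \<in> measurable coins (count_space UNIV)"
proof -
  have "(\<lambda>s. s i) \<in> measurable coins (measure_pmf (bernoulli_pmf (1/2)))"
    unfolding coins_def by (rule measurable_component_singleton) simp
  then show ?thesis by (simp add: measurable_def)
qed

lemma coin_num_eq_iff: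
  assumes "v < 2 ^ n"
  shows "coin_num n s = v \<longleftrightarrow> (\<forall>j<n. s j = bit v j)"
proof -
  have "j < n" if "bit v j" for j
    using assms that by (metis bit_take_bit_iff take_bit_nat_eq_self)
  then show ?thesis by (auto simp: bit_eq_iff bit_coin_num)
qed

lemma coin_num_measurable: "coin_num n \<in> measurable coins (count_space UNIV)"
proof -
  have "horner_sum of_bool (2::nat) (map s [0..<n]) = (\<Sum>j<n. of_bool (s j) * 2 ^ j)" for s
    by (simp add: horner_sum_eq_sum atLeast0LessThan)
  moreover have "(\<lambda>s. \<Sum>j<n. of_bool (s j) * 2 ^ j) \<in> measurable coins (count_space (UNIV :: nat set))"
    using coin_measurable by measurable
  ultimately show ?thesis by (simp add: coin_num_def[abs_def])
qed

lemma coin_num_eq_in_sets: "{s. coin_num n s = v} \<in> sets coins"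
proof -
  have "{s. coin_num n s = v} = coin_num n -` {v} \<inter> space coins"
    by (auto simp: space_coins)
  also have "\<dots> \<in> sets coins"
    by (rule measurable_sets[OF coin_num_measurable]) (rule sets_UNIV)
  finally show ?thesis .
qed

text \<open>Fixing the number fixes the first \<open>n\<close> coins, so the event is a cylinder
  whose measure is a product of \<open>n\<close> halves.\<close>

lemma prob_coin_num_eq:
  assumes "v < 2 ^ n"
  shows "measure coins {s. coin_num n s = v} = 1 / 2 ^ n"
proof -
  have half: "measure (measure_pmf (bernoulli_pmf (1/2))) {b} = 1 / 2" for b
    by (cases b) (simp_all add: measure_pmf_single)
  have product: "product_prob_space (\<lambda>_. measure_pmf (bernoulli_pmf (1/2)))"
    by (rule product_prob_spaceI) (rule prob_space_measure_pmf)
  have "{s. coin_num n s = v} = prod_emb UNIV (\<lambda>_. measure_pmf (bernoulli_pmf (1/2))) {..<n}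
          (PiE {..<n} (\<lambda>j. {bit v j}))"
    unfolding coin_num_eq_iff[OF assms] prod_emb_def
    by (simp only: set_eq_iff mem_Collect_eq vimage_eq Int_iff restrict_PiE_iff PiE_UNIV_domain
        space_measure_pmf Pi_UNIV UNIV_I simp_thms Ball_def lessThan_iff singleton_iff)
  then have "measure coins {s. coin_num n s = v} =
      (\<Prod>j<n. measure (measure_pmf (bernoulli_pmf (1/2))) {bit v j})"
    unfolding coins_def
    by (simp only:) (rule product_prob_space.measure_PiM_emb[OF product], auto)
  also have "\<dots> = (\<Prod>j<n. 1 / 2)"
    by (rule prod.cong) (auto simp: half)
  finally show ?thesis by (simp add: power_one_over)
qed

lemma prob_coin_num:
  "measure coins {s. P (coin_num n s)} = real (card {v. v < 2 ^ n \<and> P v}) / 2 ^ n"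
proof -
  let ?V = "{v. v < 2 ^ n \<and> P v}" and ?S = "\<lambda>v. {s. coin_num n s = v}"
  have finite: "finite_measure coins"
    by (rule prob_space.finite_measure[OF prob_space_coins])
  have sets: "?S ` ?V \<subseteq> sets coins"
    using coin_num_eq_in_sets by (rule image_subsetI)
  have disj: "disjoint_family_on ?S ?V" by (auto simp: disjoint_family_on_def)
  have "{s. P (coin_num n s)} = (\<Union>v\<in>?V. ?S v)"
    using coin_num_less by auto
  then have "measure coins {s. P (coin_num n s)} = measure coins (\<Union>v\<in>?V. ?S v)"
    by (rule arg_cong)
  also have "\<dots> = (\<Sum>v\<in>?V. measure coins (?S v))"
    by (rule finite_measure.finite_measure_finite_Union[OF finite _ sets disj]) simp
  also have "\<dots> = (\<Sum>v\<in>?V. 1 / 2 ^ n)"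
    using prob_coin_num_eq by (intro sum.cong) auto
  also have "\<dots> = real (card ?V) / 2 ^ n" by simp
  finally show ?thesis .
qed

text \<open>With constant time, a set \<open>X\<close> of positive probability contains
  \<open>c\<close>, so conditioning on it is void.\<close>

lemma coin_sampler_time_oblivious:
  fixes \<mu> :: "'a pmf"
  assumes lower: "\<And>E. measure \<mu> E - \<delta> \<le> real (card {v. v < 2 ^ n \<and> f v \<in> E}) / 2 ^ n"
  shows "time_oblivious_sampler 0 \<delta> (measure_pmf \<mu>) (\<lambda>s. f (coin_num n s)) (\<lambda>_. c)"
proof -
  have total: "measure coins UNIV = 1"
    using prob_space.prob_space[OF prob_space_coins] by (simp add: space_coins)
  have A: "(\<lambda>s. f (coin_num n s)) \<in> measurable coins (measure_pmf \<mu>)"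
    using measurable_compose[OF coin_num_measurable, of f "measure_pmf \<mu>"] by simp
  have "cond_prob coins (\<lambda>s. f (coin_num n s) \<in> E) (\<lambda>_. c \<in> X) =
      real (card {v. v < 2 ^ n \<and> f v \<in> E}) / 2 ^ n" if "c \<in> X" for E X
    using total that prob_coin_num[of "\<lambda>v. f v \<in> E" n] by (simp add: cond_prob_def space_coins)
  moreover have "real (card {v. v < 2 ^ n \<and> f v \<in> E}) / 2 ^ n \<le> measure \<mu> E + \<delta>" for E
  proof -
    \<comment> \<open>For \<open>\<epsilon> = 0\<close> the upper bound is the lower bound applied
      to the complement.\<close>
    have "{v. v < 2 ^ n \<and> f v \<in> E} = {..<2^n} - {v. v < 2 ^ n \<and> f v \<in> - E}" by auto
    then have "card {v. v < 2 ^ n \<and> f v \<in> E} = 2 ^ n - card {v. v < 2 ^ n \<and> f v \<in> - E}"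
      by (simp add: card_Diff_subset subset_eq)
    moreover have "card {v. v < 2 ^ n \<and> f v \<in> - E} \<le> card {..<2^n :: nat}"
      by (intro card_mono) auto
    ultimately have "real (card {v. v < 2 ^ n \<and> f v \<in> E}) / 2 ^ n =
        1 - real (card {v. v < 2 ^ n \<and> f v \<in> - E}) / 2 ^ n"
      by (simp add: of_nat_diff field_simps)
    moreover have "measure \<mu> (- E) = 1 - measure \<mu> E"
      using measure_pmf.prob_compl[of E \<mu>] by (simp add: Compl_eq_Diff_UNIV)
    ultimately show ?thesis using lower[of "- E"] by linarith
  qed
  ultimately show ?thesis
    unfolding time_oblivious_sampler_def using A lower
    by (auto simp: space_coins)
qed


section \<open>The oracle table\<close>

text \<open>Replies put the most significant bit first, hence the reversal.\<close>

definition bits_value :: "bool list \<Rightarrow> nat" where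
  "bits_value bs = horner_sum of_bool 2 (rev bs)"

text \<open>Halving \<open>\<lfloor>p * 2 ^ Suc l\<rfloor>\<close> gives
  \<open>\<lfloor>p * 2 ^ l\<rfloor>\<close>, and the lost parity is the last bit. The bound
  \<open>p < 1\<close> makes the integer part vanish in the base case.\<close>

lemma bits_value_first_bits:
  assumes "0 \<le> p" "p < 1"
  shows "bits_value (first_bits p l) = nat \<lfloor>p * 2 ^ l\<rfloor>"
proof (induction l)
  case 0
  have "\<lfloor>p\<rfloor> = 0" using assms by linarith
  then show ?case by (simp add: bits_value_def first_bits_def)
next
  case (Suc l)
  have half: "\<lfloor>p * 2 ^ Suc l\<rfloor> div 2 = \<lfloor>p * 2 ^ l\<rfloor>"
    using floor_divide_real_eq_div[of 2 "p * 2 ^ Suc l"] by simp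
  have "0 \<le> \<lfloor>p * 2 ^ Suc l\<rfloor>" using assms by simp
  then obtain n where n: "\<lfloor>p * 2 ^ Suc l\<rfloor> = int n" by (metis nonneg_int_cases)
  have "bits_value (first_bits p (Suc l)) = of_bool (odd \<lfloor>p * 2 ^ Suc l\<rfloor>) + 2 * nat \<lfloor>p * 2 ^ l\<rfloor>"
    using Suc by (simp add: bits_value_def first_bits_def)
  also have "\<dots> = nat \<lfloor>p * 2 ^ Suc l\<rfloor>"
    unfolding half[symmetric] n using odd_two_times_div_two_succ[of n]
    by (cases "even n") (auto simp: nat_div_distrib odd_two_times_div_two_nat)
  finally show ?case .
qed

text \<open>Label 0 is never queried and takes the weight left over by the others. Hence the weights sum to
  exactly \<open>2 ^ L\<close>, and a probability 1, whose bits are all 0, is never read off the oracle.\<close>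

definition reply_weight :: "nat \<Rightarrow> bool list list \<Rightarrow> nat \<Rightarrow> nat" where
  "reply_weight L bss x =
     (if x = 0 then 2 ^ L - (\<Sum>j<length bss. bits_value (bss ! j))
      else if x \<le> length bss then bits_value (bss ! (x - 1)) else 0)"

definition encode_table :: "nat \<Rightarrow> nat \<Rightarrow> (nat \<Rightarrow> nat) \<Rightarrow> bool list" where
  "encode_table L n e = map (\<lambda>p. bit (e (p div L)) (p mod L)) [0..<n * L]"

lemma table_entry_encode:
  assumes "i < n" "e i < 2 ^ L"
  shows "table_entry (encode_table L n e) L i = e i"
proof (rule bit_eqI)
  fix j
  show "bit (table_entry (encode_table L n e) L i) j = bit (e i) j"
  proof (cases "j < L")
    case True
    then have "i * L + j < Suc i * L" by simp
    also have "Suc i * L \<le> n * L" using assms(1) by (intro mult_le_mono1) simp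
    finally have "i * L + j < n * L" .
    then show ?thesis
      using True by (simp add: table_entry_def encode_table_def bit_take_bit_iff bit_drop_bit_eq
          bit_horner_sum_bit_iff)
  next
    case False
    then have "\<not> bit (e i) j"
      using assms(2) by (metis bit_take_bit_iff take_bit_nat_eq_self)
    then show ?thesis using False by (simp add: table_entry_def bit_take_bit_iff)
  qed
qed

definition is_alias_table :: "nat \<Rightarrow> nat \<Rightarrow> (nat \<Rightarrow> nat) \<Rightarrow> bool list \<Rightarrow> bool" where
  "is_alias_table k L w M \<longleftrightarrow> length M = 2 ^ k * L \<and>
     (\<forall>x<2 ^ k. card {v. v < 2 ^ L \<and> alias_sample (2 ^ k) (\<lambda>i. table_entry M L i div 2 ^ k)
        (\<lambda>i. table_entry M L i mod 2 ^ k) v = x} = w x)"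

lemma alias_sample_cong:
  assumes "\<And>i. i < n \<Longrightarrow> t i = t' i" "\<And>i. i < n \<Longrightarrow> a i = a' i" "n > 0"
  shows "alias_sample n t a = alias_sample n t' a'"
  using assms by (auto simp: alias_sample_def fun_eq_iff)

lemma ex_alias_table:
  assumes "sum w {..<2 ^ k} = 2 ^ L" "k \<le> L"
  shows "\<exists>M. is_alias_table k L w M"
proof -
  have L: "(2::nat) ^ L = 2 ^ k * 2 ^ (L - k)" using assms(2) by (simp flip: power_add)
  then obtain t a where ta: "\<And>i. i < 2 ^ k \<Longrightarrow> t i < 2 ^ (L - k)" "\<And>i. i < 2 ^ k \<Longrightarrow> a i < 2 ^ k"
    "\<And>x. x < 2 ^ k \<Longrightarrow> w x = t x + (\<Sum>i | i < 2 ^ k \<and> a i = x. 2 ^ (L - k) - t i)"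
    using alias_table_exists[of "{..<2 ^ k}" w "2 ^ (L - k)"] assms(1) by auto
  \<comment> \<open>Alias in the \<open>k\<close> low bits and threshold above;
    \<open>t i < 2 ^ (L - k)\<close> keeps the entry within \<open>L\<close> bits.\<close>
  define e where "e i = t i * 2 ^ k + a i" for i
  define M where "M = encode_table L (2 ^ k) e"
  have entry: "table_entry M L i = e i" if "i < 2 ^ k" for i
  proof -
    have "e i < Suc (t i) * 2 ^ k" using ta(2)[OF that] by (simp add: e_def)
    also have "\<dots> \<le> 2 ^ (L - k) * 2 ^ k" using ta(1)[OF that] by (intro mult_le_mono1) simp
    finally show ?thesis unfolding M_def using that L by (intro table_entry_encode) (auto simp: mult.commute)
  qed
  have s: "alias_sample (2 ^ k) (\<lambda>i. table_entry M L i div 2 ^ k) (\<lambda>i. table_entry M L i mod 2 ^ k) =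
      alias_sample (2 ^ k) t a"
    using entry ta(2) by (intro alias_sample_cong) (auto simp: e_def)
  have "is_alias_table k L w M"
    unfolding is_alias_table_def s L
    using card_alias_sample[of "2 ^ k" t "2 ^ (L - k)" _ a] ta(1,3)
    by (simp add: M_def encode_table_def)
  then show ?thesis ..
qed

text \<open>A function of the replies alone, so that one preprocessing program serves all
  distributions. Where the weights admit no table the value is arbitrary;
  \<open>reply_weight_ge\<close> excludes this for genuine replies.\<close>

definition oracle_table :: "nat \<Rightarrow> nat \<Rightarrow> bool list list \<Rightarrow> bool list" where
  "oracle_table k L bss = (SOME M. is_alias_table k L (reply_weight L bss) M)"

text \<open>Labels above \<open>length bss\<close> have weight 0; they pad the columns to a power of
  two.\<close>

lemma sum_reply_weight:
  assumes "(\<Sum>j<length bss. bits_value (bss ! j)) \<le> 2 ^ L" "length bss < n"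
  shows "sum (reply_weight L bss) {..<n} = 2 ^ L"
proof -
  have "sum (reply_weight L bss) {..<n} = sum (reply_weight L bss) {..<Suc (length bss)}"
    using assms(2) by (intro sum.mono_neutral_right) (auto simp: reply_weight_def)
  also have "\<dots> = 2 ^ L - (\<Sum>j<length bss. bits_value (bss ! j)) + (\<Sum>j<length bss. bits_value (bss ! j))"
    unfolding sum.lessThan_Suc_shift by (auto simp: reply_weight_def)
  finally show ?thesis using assms(1) by simp
qed

lemma oracle_table:
  assumes "(\<Sum>j<length bss. bits_value (bss ! j)) \<le> 2 ^ L" "length bss < 2 ^ k" "k \<le> L"
  shows "is_alias_table k L (reply_weight L bss) (oracle_table k L bss)"
  unfolding oracle_table_def
  by (rule someI_ex, rule ex_alias_table) (use sum_reply_weight assms in auto)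

text \<open>The part of \<open>E\<close> outside \<open>C\<close> costs at most
  \<open>\<eta>\<close>, and each of the at most \<open>m\<close> labels in \<open>E\<close> loses
  at most one unit \<open>1 / 2 ^ L\<close>.\<close>

lemma sampling_error:
  fixes \<mu> :: "'a pmf" and f :: "nat \<Rightarrow> nat"
  assumes C: "bij_betw lab {..<m} C" "measure \<mu> C \<ge> 1 - \<eta>"
    and w: "\<And>x. x < m \<Longrightarrow> real (card {v. v < 2 ^ L \<and> f v = x}) \<ge> pmf \<mu> (lab x) * 2 ^ L - 1"
    and m: "real m / 2 ^ L \<le> \<eta>'"
  shows "measure \<mu> E - (\<eta> + \<eta>') \<le> real (card {v. v < 2 ^ L \<and> lab (f v) \<in> E}) / 2 ^ L"
proof -
  let ?X = "{x. x < m \<and> lab x \<in> E}"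
  have img: "lab ` ?X = C \<inter> E" and inj: "inj_on lab ?X"
    using C(1) by (auto simp: bij_betw_def inj_on_def)
  have "measure \<mu> E \<le> measure \<mu> (C \<inter> E) + measure \<mu> (- C)"
    by (rule order_trans[OF measure_pmf.finite_measure_mono measure_Un_le]) auto
  moreover have "measure \<mu> (- C) = 1 - measure \<mu> C"
    using measure_pmf.prob_compl[of C \<mu>] by (simp add: Compl_eq_Diff_UNIV)
  moreover have "measure \<mu> (C \<inter> E) = (\<Sum>x\<in>?X. pmf \<mu> (lab x))"
    unfolding img[symmetric] by (simp add: measure_measure_pmf_finite sum.reindex[OF inj])
  ultimately have "(measure \<mu> E - \<eta>) * 2 ^ L \<le> (\<Sum>x\<in>?X. pmf \<mu> (lab x)) * 2 ^ L"
    using C(2) by (intro mult_right_mono) auto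
  also have "\<dots> = (\<Sum>x\<in>?X. pmf \<mu> (lab x) * 2 ^ L - 1) + card ?X"
    by (simp add: sum_subtractf sum_distrib_right)
  also have "\<dots> \<le> (\<Sum>x\<in>?X. real (card {v. v < 2 ^ L \<and> f v = x})) + m"
  proof (intro add_mono sum_mono)
    have "card ?X \<le> card {..<m}" by (intro card_mono) auto
    then show "real (card ?X) \<le> real m" by simp
  qed (use w in auto)
  also have "(\<Sum>x\<in>?X. real (card {v. v < 2 ^ L \<and> f v = x})) =
      real (card (\<Union>x\<in>?X. {v. v < 2 ^ L \<and> f v = x}))"
    by (subst card_UN_disjoint) auto
  also have "\<dots> \<le> real (card {v. v < 2 ^ L \<and> lab (f v) \<in> E})"
    by (intro of_nat_mono card_mono) auto
  finally have "measure \<mu> E - \<eta> \<le> (real (card {v. v < 2 ^ L \<and> lab (f v) \<in> E}) + m) / 2 ^ L"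
    by (simp add: field_simps)
  then show ?thesis using m by (simp add: add_divide_distrib)
qed

text \<open>Rounding down leaves label 0 at least its true share, while every other label loses less
  than one unit.\<close>

lemma reply_weight_ge:
  fixes \<mu> :: "'a pmf"
  assumes inj: "inj_on lab {..<m}" and C: "lab ` {..<m} \<subseteq> set_pmf \<mu>" and m: "m \<ge> 1"
    and obin: "\<And>x. x < m \<Longrightarrow> obin (lab x) L = first_bits (pmf \<mu> (lab x)) L"
  defines "bss \<equiv> map (\<lambda>x. obin (lab x) L) [1..<m]"
  shows "(\<Sum>j<length bss. bits_value (bss ! j)) \<le> 2 ^ L"
    and "\<And>x. x < m \<Longrightarrow> real (reply_weight L bss x) \<ge> pmf \<mu> (lab x) * 2 ^ L - 1"
proof -
  let ?p = "\<lambda>x. pmf \<mu> (lab x)"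
  \<comment> \<open>Together with \<open>pos\<close> this puts every queried probability strictly
    below 1, where the bits determine the rounded value.\<close>
  have two: "?p x + ?p 0 \<le> 1" if "1 \<le> x" "x < m" for x
  proof -
    have "lab x \<noteq> lab 0" using inj_onD[OF inj, of x 0] that by auto
    then have "?p x + ?p 0 = measure \<mu> {lab x, lab 0}"
      by (simp add: measure_measure_pmf_finite)
    then show ?thesis by simp
  qed
  have pos: "?p 0 > 0" using C m by (auto simp: pmf_positive_iff)
  have val: "bits_value (bss ! j) = nat \<lfloor>?p (Suc j) * 2 ^ L\<rfloor>" if "j < length bss" for j
  proof -
    have "Suc j < m" using that by (simp add: bss_def)
    then have "?p (Suc j) < 1" using two[of "Suc j"] pos by simp
    then show ?thesis using that obin[of "Suc j"] by (simp add: bss_def bits_value_first_bits)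
  qed
  have len: "length bss = m - 1" by (simp add: bss_def)
  have "(\<Sum>j<m - 1. ?p (Suc j)) + ?p 0 = (\<Sum>x<m. ?p x)"
    using m by (cases m) (simp_all add: sum.lessThan_Suc_shift del: sum.lessThan_Suc)
  also have "\<dots> = measure \<mu> (lab ` {..<m})"
    by (simp add: measure_measure_pmf_finite sum.reindex[OF inj])
  also have "\<dots> \<le> 1" by simp
  finally have total: "(\<Sum>j<m - 1. ?p (Suc j)) * 2 ^ L \<le> (1 - ?p 0) * 2 ^ L"
    by (intro mult_right_mono) auto
  have "real (\<Sum>j<length bss. bits_value (bss ! j)) \<le> (\<Sum>j<m - 1. ?p (Suc j) * 2 ^ L)"
    unfolding of_nat_sum len using val len by (intro sum_mono) simp
  also have "\<dots> \<le> 2 ^ L - ?p 0 * 2 ^ L"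
    using total unfolding sum_distrib_right[symmetric] by (simp only: left_diff_distrib mult_1)
  finally have sum: "real (\<Sum>j<length bss. bits_value (bss ! j)) \<le> 2 ^ L - ?p 0 * 2 ^ L" .
  also have "\<dots> \<le> 2 ^ L" by simp
  finally have "real (\<Sum>j<length bss. bits_value (bss ! j)) \<le> real (2 ^ L)" by simp
  then show le: "(\<Sum>j<length bss. bits_value (bss ! j)) \<le> 2 ^ L" by (simp only: of_nat_le_iff)
  show "real (reply_weight L bss x) \<ge> ?p x * 2 ^ L - 1" if "x < m" for x
  proof (cases "x = 0")
    case True
    then show ?thesis using sum le by (simp add: reply_weight_def of_nat_diff)
  next
    case False
    then have "reply_weight L bss x = nat \<lfloor>?p x * 2 ^ L\<rfloor>"
      using that val[of "x - 1"] len by (simp add: reply_weight_def)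
    then show ?thesis by simp
  qed
qed


section \<open>Table dimensions\<close>

lemma ceiling_log_bounds:
  fixes x :: real
  assumes "x \<ge> 1"
  shows "x \<le> 2 ^ nat \<lceil>log 2 x\<rceil>" "2 ^ nat \<lceil>log 2 x\<rceil> \<le> 2 * x" "real (nat \<lceil>log 2 x\<rceil>) \<le> log 2 x + 1"
proof -
  have "log 2 x \<ge> 0" using assms by simp
  have "x = 2 powr log 2 x" using assms by simp
  also have "\<dots> \<le> 2 powr real (nat \<lceil>log 2 x\<rceil>)"
    using \<open>log 2 x \<ge> 0\<close> by (intro powr_mono) linarith+
  also have "\<dots> = 2 ^ nat \<lceil>log 2 x\<rceil>" by (rule powr_realpow) simp
  finally show "x \<le> 2 ^ nat \<lceil>log 2 x\<rceil>" .
  show le: "real (nat \<lceil>log 2 x\<rceil>) \<le> log 2 x + 1" using \<open>log 2 x \<ge> 0\<close> by linarith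
  have "2 ^ nat \<lceil>log 2 x\<rceil> = 2 powr real (nat \<lceil>log 2 x\<rceil>)" by (simp add: powr_realpow)
  also have "\<dots> \<le> 2 powr (log 2 x + 1)" using le by (intro powr_mono) auto
  also have "\<dots> = 2 * x" using assms by (simp add: powr_add)
  finally show "2 ^ nat \<lceil>log 2 x\<rceil> \<le> 2 * x" .
qed

definition index_bits :: "nat \<Rightarrow> nat" where
  "index_bits m = nat \<lceil>log 2 (real m)\<rceil>"

definition entry_bits :: "nat \<Rightarrow> real \<Rightarrow> nat" where
  "entry_bits m \<delta> = nat \<lceil>log 2 (2 / \<delta>)\<rceil> + index_bits m"

lemma table_bits_eq: "table_bits m \<delta> = 2 ^ index_bits m * entry_bits m \<delta>"
  by (simp add: table_bits_def index_bits_def entry_bits_def)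

lemma le_exp_index_bits:
  assumes m: "m \<ge> 1"
  shows "m \<le> 2 ^ index_bits m"
proof -
  have "real m \<le> real (2 ^ index_bits m)"
    using ceiling_log_bounds(1)[of "real m"] m by (simp add: index_bits_def)
  then show ?thesis by (simp only: of_nat_le_iff)
qed

lemma exp_index_bits_le:
  assumes m: "m \<ge> 1"
  shows "real (2 ^ index_bits m) \<le> 2 * real m"
  using ceiling_log_bounds(2)[of "real m"] m by (simp add: index_bits_def)

text \<open>The 3 consists of one bit for the factor 2 in \<open>2 / \<delta>\<close> and one for
  each of the two ceilings.\<close>

lemma entry_bits_le:
  assumes m: "m \<ge> 1" and \<delta>: "0 < \<delta>" "\<delta> < 1"
  shows "real (entry_bits m \<delta>) \<le> log 2 (real m) + log 2 (1 / \<delta>) + 3"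
proof -
  have "log 2 (2 / \<delta>) = log 2 (1 / \<delta>) + 1"
    using \<delta> log_mult[of 2 "1 / \<delta>" 2] by simp
  moreover have "real (index_bits m) \<le> log 2 (real m) + 1"
    unfolding index_bits_def using m by (intro ceiling_log_bounds(3)) simp
  moreover have "real (nat \<lceil>log 2 (2 / \<delta>)\<rceil>) \<le> log 2 (2 / \<delta>) + 1"
    using \<delta> by (intro ceiling_log_bounds(3)) simp
  ultimately show ?thesis unfolding entry_bits_def of_nat_add by linarith
qed

lemma index_bits_less_entry_bits:
  assumes \<delta>: "0 < \<delta>" "\<delta> < 1"
  shows "index_bits m < entry_bits m \<delta>"
proof -
  have "log 2 (2 / \<delta>) > 0" using \<delta> by simp
  then show ?thesis by (simp add: entry_bits_def)
qed

lemma granularity: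
  assumes m: "m \<ge> 1" and \<delta>: "0 < \<delta>" "\<delta> < 1"
  shows "real m / 2 ^ entry_bits m \<delta> \<le> \<delta> / 2"
proof -
  have "2 / \<delta> \<le> 2 ^ nat \<lceil>log 2 (2 / \<delta>)\<rceil>" using ceiling_log_bounds(1)[of "2 / \<delta>"] \<delta> by simp
  moreover have "real m \<le> 2 ^ index_bits m"
    using le_exp_index_bits[OF m] by (metis of_nat_le_iff of_nat_numeral of_nat_power)
  ultimately have "2 / \<delta> * real m \<le> 2 ^ entry_bits m \<delta>"
    unfolding entry_bits_def power_add by (intro mult_mono) auto
  then show ?thesis using \<delta> by (simp add: field_simps)
qed

lemma table_bits_le:
  assumes m: "m \<ge> 1" and \<delta>: "0 < \<delta>" "\<delta> < 1"
  shows "real (table_bits m \<delta>) \<le> 12 * max 1 (real m * (ln (1 / \<delta>) + ln (real m)))"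
proof -
  define y where "y = ln (1 / \<delta>) + ln (real m)"
  have y: "y \<ge> 0" using m \<delta> by (simp add: y_def)
  have ln2: "ln 2 \<ge> (2 / 3 :: real)" using ln2_ge_two_thirds .
  have "log 2 (real m) + log 2 (1 / \<delta>) = y / ln 2" by (simp add: log_def y_def add_divide_distrib)
  also have "\<dots> \<le> y / (2 / 3)" using ln2 y by (intro divide_left_mono) auto
  finally have L: "real (entry_bits m \<delta>) \<le> 3 / 2 * y + 3" using entry_bits_le[OF m \<delta>] by simp
  have "real (table_bits m \<delta>) \<le> 2 * real m * (3 / 2 * y + 3)"
    unfolding table_bits_eq of_nat_mult
    using L exp_index_bits_le[OF m] by (intro mult_mono) auto
  also have "\<dots> = 3 * (real m * y) + 6 * real m" by (simp add: algebra_simps)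
  \<comment> \<open>For \<open>m \<ge> 2\<close>, \<open>y \<ge> 2 / 3\<close> gives
    \<open>6 * m \<le> 9 * (m * y)\<close>; for \<open>m = 1\<close> the maximum with 1 absorbs the
    6.\<close>
  also have "\<dots> \<le> 12 * max 1 (real m * y)"
  proof (cases "m = 1")
    case False
    then have "ln 2 \<le> ln (real m)" using m by simp
    moreover have "0 \<le> ln (1 / \<delta>)" using \<delta> by simp
    ultimately have "2 / 3 \<le> y" using ln2 unfolding y_def by linarith
    then have "real m * (2 / 3) \<le> real m * y" by (intro mult_left_mono) auto
    then show ?thesis by linarith
  qed simp
  finally show ?thesis by (simp add: y_def)
qed

text \<open>If the index had more than \<open>\<omega>\<close> bits, so would an entry, and the
  table would exceed \<open>\<omega> * 2 ^ \<omega>\<close> bits.\<close>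

lemma index_bits_le_word:
  assumes \<delta>: "0 < \<delta>" "\<delta> < 1" and fits: "table_bits m \<delta> \<le> \<omega> * 2 ^ \<omega>"
  shows "index_bits m \<le> \<omega>"
proof (rule ccontr)
  assume "\<not> ?thesis"
  then have "2 ^ \<omega> * \<omega> < 2 ^ index_bits m * entry_bits m \<delta>"
    using index_bits_less_entry_bits[OF \<delta>, of m]
    by (intro mult_le_less_imp_less) (auto intro!: power_increasing)
  then show False using fits by (simp add: table_bits_eq mult.commute)
qed

lemma entry_bits_less_two_words:
  assumes "table_bits m \<delta> \<le> \<omega> * 2 ^ \<omega>"
  shows "entry_bits m \<delta> < 2 ^ \<omega> * 2 ^ \<omega>"
proof -
  have "entry_bits m \<delta> \<le> 2 ^ index_bits m * entry_bits m \<delta>" by simp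
  also have "\<dots> \<le> \<omega> * 2 ^ \<omega>" using assms by (simp add: table_bits_eq)
  also have "\<dots> < 2 ^ \<omega> * 2 ^ \<omega>" using less_exp[of \<omega>] by simp
  finally show ?thesis .
qed

text \<open>The quotient is at most \<open>X / \<omega> + 3\<close>, hence at most 4 times the
  maximum, and \<open>93 = 37 + 14 * 4\<close>.\<close>

lemma sample_time_le:
  assumes m: "m \<ge> 1" and \<delta>: "0 < \<delta>" "\<delta> < 1" and \<omega>: "\<omega> \<ge> 1"
  shows "real (37 + 14 * (entry_bits m \<delta> div \<omega>)) \<le>
    93 * max 1 (1 / real \<omega> * (log 2 (real m) + log 2 (1 / \<delta>)))"
proof -
  define X where "X = log 2 (real m) + log 2 (1 / \<delta>)"
  have "real (entry_bits m \<delta> div \<omega>) \<le> real (entry_bits m \<delta>) / real \<omega>"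
    by (rule of_nat_div_le_of_nat)
  also have "\<dots> \<le> (X + 3) / real \<omega>"
    using entry_bits_le[OF m \<delta>] by (intro divide_right_mono) (auto simp: X_def)
  also have "\<dots> = 1 / real \<omega> * X + 3 / real \<omega>" by (simp add: add_divide_distrib)
  also have "3 / real \<omega> \<le> 3" using \<omega> by (simp add: field_simps)
  finally have "real (entry_bits m \<delta> div \<omega>) \<le> 1 / real \<omega> * X + 3" by simp
  then show ?thesis unfolding X_def[symmetric] by simp
qed

section \<open>Assembly of the sampler\<close>

lemma ex_ram_sampler:
  fixes \<mu> :: "'a pmf"
  assumes m: "m \<ge> 1" and \<delta>: "0 < \<delta>" "\<delta> < 1" and \<omega>: "\<omega> \<ge> 1"
    and fits: "table_bits m \<delta> \<le> \<omega> * 2 ^ \<omega>"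
    and C: "C \<subseteq> set_pmf \<mu>" "measure \<mu> C \<ge> 1 - \<delta> / 2"
    and lab: "bij_betw lab {..<m} C" and obin: "bin_oracle \<mu> C obin"
  defines "k \<equiv> index_bits m" and "L \<equiv> entry_bits m \<delta>"
  shows "\<exists>A. ram_sampler \<omega> (table_bits m \<delta>) lab obin (prep_prog \<omega> L m (oracle_table k L))
      (sample_prog \<omega> k L) A (\<lambda>_. 37 + 14 * (L div \<omega>)) (\<lambda>_. L) \<and>
    time_oblivious_sampler 0 \<delta> (measure_pmf \<mu>) A (\<lambda>_. 37 + 14 * (L div \<omega>))"
proof -
  have kL: "k < L" unfolding k_def L_def using \<delta> by (rule index_bits_less_entry_bits)
  have k\<omega>: "k \<le> \<omega>" unfolding k_def using \<delta> fits by (rule index_bits_le_word)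
  have mk: "m \<le> 2 ^ k" unfolding k_def using m by (rule le_exp_index_bits)
  have N: "table_bits m \<delta> = 2 ^ k * L" by (simp add: table_bits_eq k_def L_def)
  have inj: "inj_on lab {..<m}" and img: "lab ` {..<m} = C" using lab by (auto simp: bij_betw_def)
  \<comment> \<open>\<open>bin_oracle\<close> constrains only lengths of at least 1, which
    \<open>k < L\<close> provides.\<close>
  have reply: "obin (lab x) L = first_bits (pmf \<mu> (lab x)) L" if "x < m" for x
    using obin kL that img by (auto simp: bin_oracle_def)
  define bss where "bss = map (\<lambda>x. obin (lab x) L) [1..<m]"
  have weight: "(\<Sum>j<length bss. bits_value (bss ! j)) \<le> 2 ^ L"
    "\<And>x. x < m \<Longrightarrow> real (reply_weight L bss x) \<ge> pmf \<mu> (lab x) * 2 ^ L - 1"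
    unfolding bss_def using reply_weight_ge[where \<mu> = \<mu> and lab = lab and obin = obin, OF inj _ m reply] img C(1)
    by auto
  define M where "M = oracle_table k L bss"
  have "length bss < 2 ^ k" using m mk by (simp add: bss_def)
  then have M: "is_alias_table k L (reply_weight L bss) M"
    unfolding M_def using weight(1) kL by (intro oracle_table) auto
  then have len: "length M = 2 ^ k * L" by (simp add: is_alias_table_def)
  define f where "f = alias_sample (2 ^ k) (\<lambda>i. table_entry M L i div 2 ^ k) (\<lambda>i. table_entry M L i mod 2 ^ k)"
  define A where "A s = lab (f (coin_num L s))" for s
  have "real (card {v. v < 2 ^ L \<and> f v = x}) \<ge> pmf \<mu> (lab x) * 2 ^ L - 1" if "x < m" for x
    using M weight(2)[OF that] that mk by (simp add: is_alias_table_def f_def)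
  \<comment> \<open>The budget \<open>\<delta>\<close> splits evenly between the mass outside the
    core and the rounding.\<close>
  from sampling_error[OF lab C(2) this granularity[OF m \<delta>, folded L_def]]
  have "time_oblivious_sampler 0 \<delta> (measure_pmf \<mu>) A (\<lambda>_. 37 + 14 * (L div \<omega>))"
    unfolding A_def by (intro coin_sampler_time_oblivious) simp
  moreover have "\<exists>t \<sigma>. exec \<omega> lab obin s (prep_prog \<omega> L m (oracle_table k L))
      (init_state (replicate (table_bits m \<delta>) False)) t \<sigma> \<and> mem \<sigma> = M \<and> used \<sigma> = 0" for s
    unfolding N len[symmetric]
  proof (rule exec_prep_prog)
    show "m \<le> 2 ^ \<omega>" using mk k\<omega> power_increasing[of k \<omega> "2::nat"] by linarith
    show "L < 2 ^ \<omega> * 2 ^ \<omega>" unfolding L_def using fits by (rule entry_bits_less_two_words)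
    show "length (obin (lab x) L) = L" if "x < m" for x
      using reply[OF that] by (simp add: first_bits_def)
  qed (use \<omega> fits N len in \<open>auto simp: M_def bss_def\<close>)
  moreover have "\<exists>\<sigma>. exec \<omega> lab obin s (sample_prog \<omega> k L) (init_state M) (37 + 14 * (L div \<omega>)) \<sigma> \<and>
      mem \<sigma> = M \<and> used \<sigma> = L \<and> result \<sigma> = Some (A s)" for s
    unfolding A_def f_def using exec_sample_prog[OF \<omega> k\<omega>, of L] kL fits N by simp
  ultimately show ?thesis
    unfolding ram_sampler_def using len N by (intro exI[of _ A] conjI exI[of _ M] allI) auto
qed

theorem mainTheorem4:
  shows "\<exists>(c_mem :: real) (c_reg :: nat) (c_rand :: real) (c_time :: real).
    (\<forall>(m :: nat) (\<delta> :: real). m \<ge> 1 \<and> 0 < \<delta> \<and> \<delta> < 1 \<longrightarrow>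
       real (table_bits m \<delta>) \<le> c_mem * max 1 (real m * (ln (1 / \<delta>) + ln (real m)))) \<and>
    (\<forall>(\<omega> :: nat) (m :: nat) (\<delta> :: real).
       \<omega> \<ge> 1 \<and> m \<ge> 1 \<and> 0 < \<delta> \<and> \<delta> < 1 \<and> table_bits m \<delta> \<le> \<omega> * 2 ^ \<omega> \<longrightarrow>
       (\<exists>Prep Samp. regs Prep \<union> regs Samp \<subseteq> {..<c_reg} \<and>
         (\<forall>(\<mu> :: 'a pmf) C lab obin.
            minimum_core \<mu> (\<delta> / 2) C \<and> card C = m \<and> label_oracle C lab \<and> bin_oracle \<mu> C obin \<longrightarrow>
            (\<exists>A T R. ram_sampler \<omega> (table_bits m \<delta>) lab obin Prep Samp A T R \<and>
               time_oblivious_sampler 0 \<delta> (measure_pmf \<mu>) A T \<and>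
               (\<forall>s. real (R s) \<le> log 2 (real m) + log 2 (1 / \<delta>) + c_rand) \<and>
               (\<forall>s. real (T s) \<le>
                      c_time * max 1 (1 / real \<omega> * (log 2 (real m) + log 2 (1 / \<delta>))))))))"
proof (rule exI[of _ 12], rule exI[of _ 12], rule exI[of _ 3], rule exI[of _ 93],
    intro conjI allI impI; elim conjE)
  fix \<omega> m :: nat and \<delta> :: real
  assume \<omega>: "\<omega> \<ge> 1" and m: "m \<ge> 1" and \<delta>: "0 < \<delta>" "\<delta> < 1" and fits: "table_bits m \<delta> \<le> \<omega> * 2 ^ \<omega>"
  \<comment> \<open>Both programs are determined by \<open>\<omega>\<close>, \<open>m\<close> and
    \<open>\<delta>\<close> before the distribution and the oracles are fixed. The 12 registers are
    those of the sampling code; preprocessing uses the first three of them.\<close>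
  define k L where "k = index_bits m" and "L = entry_bits m \<delta>"
  let ?Prep = "prep_prog \<omega> L m (oracle_table k L)" and ?Samp = "sample_prog \<omega> k L"
  show "\<exists>Prep Samp. regs Prep \<union> regs Samp \<subseteq> {..<12} \<and>
         (\<forall>(\<mu> :: 'a pmf) C lab obin.
            minimum_core \<mu> (\<delta> / 2) C \<and> card C = m \<and> label_oracle C lab \<and> bin_oracle \<mu> C obin \<longrightarrow>
            (\<exists>A T R. ram_sampler \<omega> (table_bits m \<delta>) lab obin Prep Samp A T R \<and>
               time_oblivious_sampler 0 \<delta> (measure_pmf \<mu>) A T \<and>
               (\<forall>s. real (R s) \<le> log 2 (real m) + log 2 (1 / \<delta>) + 3) \<and>
               (\<forall>s. real (T s) \<le> 93 * max 1 (1 / real \<omega> * (log 2 (real m) + log 2 (1 / \<delta>))))))"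
  proof (rule exI[of _ ?Prep], rule exI[of _ ?Samp], intro conjI allI impI; (elim conjE)?)
    show "regs ?Prep \<union> regs ?Samp \<subseteq> {..<12}"
      using regs_prep_prog[of \<omega> L m "oracle_table k L"] regs_sample_prog[of \<omega> k L] by force
    fix \<mu> :: "'a pmf" and C lab obin
    assume "minimum_core \<mu> (\<delta> / 2) C" "card C = m" "label_oracle C lab" "bin_oracle \<mu> C obin"
    then obtain A where "ram_sampler \<omega> (table_bits m \<delta>) lab obin ?Prep ?Samp A
        (\<lambda>_. 37 + 14 * (L div \<omega>)) (\<lambda>_. L)"
      "time_oblivious_sampler 0 \<delta> (measure_pmf \<mu>) A (\<lambda>_. 37 + 14 * (L div \<omega>))"
      using ex_ram_sampler[OF m \<delta> \<omega> fits, of C \<mu> lab obin]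
      by (auto simp: minimum_core_def is_arg_min_def label_oracle_def k_def L_def)
    then show "\<exists>A T R. ram_sampler \<omega> (table_bits m \<delta>) lab obin ?Prep ?Samp A T R \<and>
               time_oblivious_sampler 0 \<delta> (measure_pmf \<mu>) A T \<and>
               (\<forall>s. real (R s) \<le> log 2 (real m) + log 2 (1 / \<delta>) + 3) \<and>
               (\<forall>s. real (T s) \<le> 93 * max 1 (1 / real \<omega> * (log 2 (real m) + log 2 (1 / \<delta>))))"
      using entry_bits_le[OF m \<delta>] sample_time_le[OF m \<delta> \<omega>] unfolding L_def by blast
  qed
qed (rule table_bits_le)

end
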